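(* Let $\mu>0$, $a\in\mathbb{R}$. The operator $\mathcal{A}_\mu$ (the realization of $\mathcal{A}+\mu\,\delta(x-a)$ defined in the context), with domain $\mathcal{D}(\mathcal{A}_\mu)$, is a self-adjoint operator in $L_2(\mathbb{R})$.
   Context: $\xi(t)$, $t\ge 0$, is a one-dimensional symmetric Lévy process with $\mathbf{E}e^{ip\xi(t)}=e^{-t\Psi(p)}$, $\Psi(p)=\frac{\sigma^2p^2}{2}+\int_{|y|>0}(1-\cos(py))\,\Pi(dy)$, where $\sigma^2\ge0$ and $\Pi$ is a symmetric $\sigma$-finite measure with $\int_{|y|>0}\min(1,y^2)\,\Pi(dy)<\infty$. Standing assumption: $\int_{\mathbb{R}}\frac{dp}{1+\Psi(p)}<\infty$. $L_2(\mathbb{R})$ is the complex Hilbert space with $(f,g)=\int f\bar g$. Fourier transform: $\widehat g(p)=\int_{\mathbb{R}}e^{ipx}g(x)\,dx$ (as an $L_2$-limit), with inverse $\frac1{2\pi}\int_{\mathbb{R}} e^{-ipx}\widehat g(p)\,dp$. $V_2^1(\mathbb{R})$ is the space of $\varphi\in L_2(\mathbb{R})$ with $\int_{\mathbb{R}}(1+\Psi^2(p))|\widehat\varphi(p)|^2dp<\infty$; its elements are identified with their continuous representatives. The operator $\mathcal{A}$ with domain $V_2^1(\mathbb{R})$ is defined by $\widehat{\mathcal{A}u}(p)=-\Psi(p)\widehat u(p)$. For $\lambda\in\mathbb{C}\setminus(-\infty,0]$, $\psi_\lambda(x)=\frac1{2\pi}\int_{\mathbb{R}}\frac{e^{-ipx}}{\Psi(p)+\lambda}\,dp$.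 The number $\nu>0$ is the one determined by $\mu\,\psi_\nu(0)=1$. $\mathcal{D}(\mathcal{A}_\mu)=\{\varphi\in V_2^1(\mathbb{R}):\varphi(a)=0\}\oplus\mathrm{Lin}(\psi_\nu(\cdot-a))$ (algebraic direct sum, $\mathrm{Lin}$ = linear span), and for $u=\varphi+C\psi_\nu(\cdot-a)\in\mathcal{D}(\mathcal{A}_\mu)$, $\mathcal{A}_\mu u=\mathcal{A}\varphi+C\nu\,\psi_\nu(\cdot-a)$. *)

theory Defs
  imports "HOL-Probability.Probability"
begin

definition square_integrable :: "(real \<Rightarrow> complex) \<Rightarrow> bool" where
  "square_integrable f \<longleftrightarrow>
     f \<in> borel_measurable lborel \<and> integrable lborel (\<lambda>x. (cmod (f x))\<^sup>2)"

definition L2_rel :: "(real \<Rightarrow> complex) \<Rightarrow> (real \<Rightarrow> complex) \<Rightarrow> bool" where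
  "L2_rel f g \<longleftrightarrow>
     square_integrable f \<and> square_integrable g \<and> (AE x in lborel. f x = g x)"

lemma square_integrable_zero: "square_integrable (\<lambda>_. 0)"
  by (simp add: square_integrable_def)

lemma square_integrable_mult:
  assumes "square_integrable f" "square_integrable g"
  shows "integrable lborel (\<lambda>x. f x * cnj (g x))"
proof -
  have m [measurable]: "f \<in> borel_measurable lborel" "g \<in> borel_measurable lborel"
    using assms by (auto simp: square_integrable_def)
  have c: "cnj \<in> borel_measurable borel"
    by (intro borel_measurable_continuous_onI continuous_intros)
  have gm: "(\<lambda>x. cnj (g x)) \<in> borel_measurable lborel"
    using measurable_compose[OF m(2) c] by simp
  show ?thesis
  proof (rule Bochner_Integration.integrable_bound)
    show "integrable lborel (\<lambda>x. (cmod (f x))\<^sup>2 + (cmod (g x))\<^sup>2)"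
      using assms by (auto simp: square_integrable_def)
    show "(\<lambda>x. f x * cnj (g x)) \<in> borel_measurable lborel"
      using m(1) gm by simp
    have "cmod a * cmod b \<le> (cmod a)\<^sup>2 + (cmod b)\<^sup>2" for a b
    proof -
      have "2 * (cmod a * cmod b) \<le> (cmod a)\<^sup>2 + (cmod b)\<^sup>2"
        using sum_squares_bound[of "cmod a" "cmod b"] by simp
      moreover have "0 \<le> cmod a * cmod b" by simp
      ultimately show ?thesis by linarith
    qed
    then show "AE x in lborel. norm (f x * cnj (g x))
        \<le> norm ((cmod (f x))\<^sup>2 + (cmod (g x))\<^sup>2)"
      by (simp add: norm_mult)
  qed
qed

lemma square_integrable_scale:
  assumes "square_integrable f"
  shows "square_integrable (\<lambda>x. c * f x)"
  using assms by (auto simp: square_integrable_def norm_mult power_mult_distrib)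

lemma square_integrable_add:
  assumes "square_integrable f" "square_integrable g"
  shows "square_integrable (\<lambda>x. f x + g x)"
proof -
  have m [measurable]: "f \<in> borel_measurable lborel" "g \<in> borel_measurable lborel"
    using assms by (auto simp: square_integrable_def)
  have "integrable lborel (\<lambda>x. (cmod (f x + g x))\<^sup>2)"
  proof (rule Bochner_Integration.integrable_bound)
    show "integrable lborel (\<lambda>x. 2 * (cmod (f x))\<^sup>2 + 2 * (cmod (g x))\<^sup>2)"
      using assms by (auto simp: square_integrable_def)
    have "(cmod (a + b))\<^sup>2 \<le> 2 * (cmod a)\<^sup>2 + 2 * (cmod b)\<^sup>2" for a b
    proof -
      have "(cmod (a + b))\<^sup>2 \<le> (cmod a + cmod b)\<^sup>2"
        by (intro power_mono norm_triangle_ineq) simp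
      also have "\<dots> \<le> 2 * (cmod a)\<^sup>2 + 2 * (cmod b)\<^sup>2"
        using sum_squares_bound[of "cmod a" "cmod b"] by (simp add: power2_sum)
      finally show ?thesis .
    qed
    then show "AE x in lborel. norm ((cmod (f x + g x))\<^sup>2)
        \<le> norm (2 * (cmod (f x))\<^sup>2 + 2 * (cmod (g x))\<^sup>2)"
      by simp
  qed measurable
  then show ?thesis by (simp add: square_integrable_def)
qed

text \<open>Since the quotient is partial, \<open>L2_of f\<close> is meaningful only for square integrable \<open>f\<close>.\<close>

quotient_type L2 = "real \<Rightarrow> complex" / partial: L2_rel
  morphisms rep_L2 L2_of
proof (rule part_equivpI)
  show "\<exists>x. L2_rel x x"
    using square_integrable_zero by (auto simp: L2_rel_def)
  show "symp L2_rel"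
    by (auto simp: symp_def L2_rel_def elim: eventually_mono)
  show "transp L2_rel"
    by (auto simp: transp_def L2_rel_def)
qed

instantiation L2 :: real_vector
begin

lift_definition zero_L2 :: L2 is "\<lambda>_. 0"
  using square_integrable_zero by (simp add: L2_rel_def)

lift_definition plus_L2 :: "L2 \<Rightarrow> L2 \<Rightarrow> L2" is "\<lambda>f g x. f x + g x"
  by (auto simp: L2_rel_def intro: square_integrable_add)

lift_definition uminus_L2 :: "L2 \<Rightarrow> L2" is "\<lambda>f x. - f x"
  using square_integrable_scale[of _ "-1"] by (auto simp: L2_rel_def)

definition minus_L2 :: "L2 \<Rightarrow> L2 \<Rightarrow> L2" where
  "minus_L2 u v = u + - v"

lift_definition scaleR_L2 :: "real \<Rightarrow> L2 \<Rightarrow> L2" is "\<lambda>c f x. of_real c * f x"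
  by (auto simp: L2_rel_def intro: square_integrable_scale)

instance
proof
  fix u v w :: L2 and r s :: real
  show "u + v + w = u + (v + w)"
    by transfer (auto simp: L2_rel_def add.assoc intro!: square_integrable_add)
  show "u + v = v + u"
    by transfer (auto simp: L2_rel_def add.commute intro!: square_integrable_add)
  show "0 + u = u"
    by transfer (auto simp: L2_rel_def)
  show "- u + u = 0"
    by transfer (auto simp: L2_rel_def square_integrable_zero)
  show "u - v = u + - v"
    by (simp add: minus_L2_def)
  show "r *\<^sub>R (u + v) = r *\<^sub>R u + r *\<^sub>R v"
    by transfer (auto simp: L2_rel_def ring_distribs
        intro!: square_integrable_add square_integrable_scale)
  show "(r + s) *\<^sub>R u = r *\<^sub>R u + s *\<^sub>R u"
    by transfer (auto simp: L2_rel_def ring_distribs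
        intro!: square_integrable_add square_integrable_scale)
  show "r *\<^sub>R s *\<^sub>R u = (r * s) *\<^sub>R u"
    by transfer (auto simp: L2_rel_def mult.assoc intro!: square_integrable_scale)
  show "1 *\<^sub>R u = u"
    by transfer (auto simp: L2_rel_def)
qed

end

lift_definition scaleC :: "complex \<Rightarrow> L2 \<Rightarrow> L2" (infixr "*\<^sub>C" 75) is "\<lambda>c f x. c * f x"
  by (auto simp: L2_rel_def intro: square_integrable_scale)

lift_definition cinner :: "L2 \<Rightarrow> L2 \<Rightarrow> complex" is
  "\<lambda>f g. LINT x|lborel. f x * cnj (g x)"
proof -
  fix f f' g g' assume *: "L2_rel f f'" "L2_rel g g'"
  show "(LINT x|lborel. f x * cnj (g x)) = (LINT x|lborel. f' x * cnj (g' x))"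
  proof (rule integral_cong_AE)
    show "AE x in lborel. f x * cnj (g x) = f' x * cnj (g' x)"
      using * by (auto simp: L2_rel_def)
  qed (use * square_integrable_mult in \<open>auto simp: L2_rel_def intro!: borel_measurable_integrable\<close>)
qed

lemma cinner_self_eq: 
  "square_integrable f \<Longrightarrow> (LINT x|lborel. f x * cnj (f x)) = of_real (LINT x|lborel. (cmod (f x))\<^sup>2)"
  unfolding complex_norm_square[symmetric] by (rule integral_complex_of_real)

instantiation L2 :: real_inner
begin

definition inner_L2 :: "L2 \<Rightarrow> L2 \<Rightarrow> real" where
  "inner_L2 u v = Re (cinner u v)"

definition norm_L2 :: "L2 \<Rightarrow> real" where
  "norm_L2 u = sqrt (inner u u)"

definition sgn_L2 :: "L2 \<Rightarrow> L2" where
  "sgn_L2 u = inverse (norm u) *\<^sub>R u"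

definition dist_L2 :: "L2 \<Rightarrow> L2 \<Rightarrow> real" where
  "dist_L2 u v = norm (u - v)"

definition uniformity_L2 :: "(L2 \<times> L2) filter" where
  "uniformity_L2 = (INF e\<in>{0<..}. principal {(u, v). dist u v < e})"

definition open_L2 :: "L2 set \<Rightarrow> bool" where
  "open_L2 U \<longleftrightarrow> (\<forall>u\<in>U. eventually (\<lambda>(u', v). u' = u \<longrightarrow> v \<in> U) uniformity)"

instance
proof
  fix u v w :: L2 and r :: real and U :: "L2 set"
  show "dist u v = norm (u - v)"
    by (rule dist_L2_def)
  show "sgn u = inverse (norm u) *\<^sub>R u"
    by (rule sgn_L2_def)
  show "uniformity = (INF e\<in>{0<..}. principal {(x :: L2, y). dist x y < e})"
    by (rule uniformity_L2_def)
  show "open U \<longleftrightarrow> (\<forall>x\<in>U. \<forall>\<^sub>F (x', y) in uniformity. x' = x \<longrightarrow> y \<in> U)"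
    by (rule open_L2_def)
  show "norm u = sqrt (inner u u)"
    by (rule norm_L2_def)
  have "cinner u v = cnj (cinner v u)"
    by transfer (subst Bochner_Integration.integral_cnj [symmetric], simp add: mult.commute)
  then show "inner u v = inner v u"
    by (simp add: inner_L2_def)
  have "cinner (u + v) w = cinner u w + cinner v w"
    by transfer (simp add: L2_rel_def ring_distribs square_integrable_mult)
  then show "inner (u + v) w = inner u w + inner v w"
    by (simp add: inner_L2_def)
  have "cinner (r *\<^sub>R u) v = of_real r * cinner u v"
    by transfer (simp add: mult.assoc)
  then show "inner (r *\<^sub>R u) v = r * inner u v"
    by (simp add: inner_L2_def)
  show "0 \<le> inner u u"
    unfolding inner_L2_def
    by transfer (simp add: L2_rel_def cinner_self_eq)
  show "inner u u = 0 \<longleftrightarrow> u = 0"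
    unfolding inner_L2_def
    by transfer (auto simp: L2_rel_def cinner_self_eq square_integrable_zero
        integral_nonneg_eq_0_iff_AE square_integrable_def)
qed

end

text \<open>An unbounded operator is represented by its graph, a set of pairs (argument, value).\<close>

definition linear_operator :: "(L2 \<times> L2) set \<Rightarrow> bool" where
  "linear_operator T \<longleftrightarrow>
     single_valued T \<and> (0, 0) \<in> T \<and>
     (\<forall>u z v w. (u, z) \<in> T \<longrightarrow> (v, w) \<in> T \<longrightarrow> (u + v, z + w) \<in> T) \<and>
     (\<forall>c u z. (u, z) \<in> T \<longrightarrow> (c *\<^sub>C u, c *\<^sub>C z) \<in> T)"

definition adjoint :: "(L2 \<times> L2) set \<Rightarrow> (L2 \<times> L2) set" where
  "adjoint T = {(v, w). \<forall>(u, z)\<in>T. cinner z v = cinner u w}"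

definition self_adjoint :: "(L2 \<times> L2) set \<Rightarrow> bool" where
  "self_adjoint T \<longleftrightarrow>
     linear_operator T \<and> closure (Domain T) = UNIV \<and> adjoint T = T"

text \<open>The limit is taken in the norm of \<^typ>\<open>L2\<close>; the truncated integrals exist because square
  integrable functions are locally integrable, and they are square integrable in \<open>p\<close>
  by Plancherel's theorem.\<close>

definition fourier :: "L2 \<Rightarrow> L2" where
  "fourier g = Lim at_top
     (\<lambda>R :: real. L2_of (\<lambda>p. LBINT x:{-R..R}. exp (\<i> * of_real (p * x)) * rep_L2 g x))"

text \<open>Path regularity is required in the form of stochastic continuity, which is implied by
  right-continuity of almost all paths.\<close>

definition levy_process :: "'w measure \<Rightarrow> (real \<Rightarrow> 'w \<Rightarrow> real) \<Rightarrow> bool" where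
  "levy_process M \<xi> \<longleftrightarrow>
     prob_space M \<and>
     (\<forall>t\<ge>0. \<xi> t \<in> borel_measurable M) \<and>
     (AE \<omega> in M. \<xi> 0 \<omega> = 0) \<and>
     (\<forall>ts :: nat \<Rightarrow> real. \<forall>n. 0 \<le> ts 0 \<longrightarrow> mono ts \<longrightarrow>
        prob_space.indep_vars M (\<lambda>_. borel) (\<lambda>i \<omega>. \<xi> (ts (Suc i)) \<omega> - \<xi> (ts i) \<omega>) {..<n}) \<and>
     (\<forall>s\<ge>0. \<forall>t\<ge>0. distr M borel (\<lambda>\<omega>. \<xi> (s + t) \<omega> - \<xi> s \<omega>) = distr M borel (\<xi> t)) \<and>
     (\<forall>t\<ge>0. \<forall>\<epsilon>>0.
        ((\<lambda>s. measure M {\<omega>\<in>space M. \<bar>\<xi> s \<omega> - \<xi> t \<omega>\<bar> > \<epsilon>}) \<longlongrightarrow> 0) (at t within {0..}))"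

definition symmetric_process :: "'w measure \<Rightarrow> (real \<Rightarrow> 'w \<Rightarrow> real) \<Rightarrow> bool" where
  "symmetric_process M \<xi> \<longleftrightarrow>
     (\<forall>t\<ge>0. distr M borel (\<lambda>\<omega>. - \<xi> t \<omega>) = distr M borel (\<xi> t))"

definition symmetric_levy_measure :: "real measure \<Rightarrow> bool" where
  "symmetric_levy_measure \<Lambda> \<longleftrightarrow>
     sets \<Lambda> = sets borel \<and> sigma_finite_measure \<Lambda> \<and> distr \<Lambda> borel uminus = \<Lambda> \<and>
     (\<integral>\<^sup>+y\<in>{y. \<bar>y\<bar> > 0}. ennreal (min 1 (y\<^sup>2)) \<partial>\<Lambda>) < \<infinity>"

definition levy_exponent :: "real \<Rightarrow> real measure \<Rightarrow> real \<Rightarrow> real" where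
  "levy_exponent \<sigma> \<Lambda> p =
     \<sigma>\<^sup>2 * p\<^sup>2 / 2 + (LINT y:{y. \<bar>y\<bar> > 0}|\<Lambda>. 1 - cos (p * y))"

definition V21 :: "(real \<Rightarrow> real) \<Rightarrow> L2 set" where
  "V21 \<Psi> = {\<phi>. integrable lborel (\<lambda>p. (1 + (\<Psi> p)\<^sup>2) * (cmod (rep_L2 (fourier \<phi>) p))\<^sup>2)}"

text \<open>The value of \<open>\<phi> \<in> V21 \<Psi>\<close> at \<open>a\<close> is that of its continuous representative. A class has
  at most one; for \<open>V21 \<Psi>\<close> it exists if \<open>1 / (1 + \<Psi>)\<close> is integrable.\<close>

definition cont_rep :: "L2 \<Rightarrow> real \<Rightarrow> complex" where
  "cont_rep \<phi> = (THE f. continuous_on UNIV f \<and> square_integrable f \<and> L2_of f = \<phi>)"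

definition generator :: "(real \<Rightarrow> real) \<Rightarrow> L2 \<Rightarrow> L2" where
  "generator \<Psi> u =
     (THE w. AE p in lborel. rep_L2 (fourier w) p = - of_real (\<Psi> p) * rep_L2 (fourier u) p)"

definition psi :: "(real \<Rightarrow> real) \<Rightarrow> complex \<Rightarrow> real \<Rightarrow> complex" where
  "psi \<Psi> z x =
     1 / (2 * of_real pi) *
       (LINT p|lborel. exp (- \<i> * of_real (p * x)) / (of_real (\<Psi> p) + z))"

definition psi_shift :: "(real \<Rightarrow> real) \<Rightarrow> real \<Rightarrow> real \<Rightarrow> L2" where
  "psi_shift \<Psi> \<nu> a = L2_of (\<lambda>x. psi \<Psi> (of_real \<nu>) (x - a))"

definition perturbed_generator :: "(real \<Rightarrow> real) \<Rightarrow> real \<Rightarrow> real \<Rightarrow> (L2 \<times> L2) set" where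
  "perturbed_generator \<Psi> \<nu> a =
     {(\<phi> + C *\<^sub>C psi_shift \<Psi> \<nu> a, generator \<Psi> \<phi> + (C * of_real \<nu>) *\<^sub>C psi_shift \<Psi> \<nu> a) |
        \<phi> C. \<phi> \<in> V21 \<Psi> \<and> cont_rep \<phi> a = 0}"

text \<open>In \<open>perturbed_generator\<close> the decomposition of an element of the domain is not assumed
  unique. That the value does not depend on it is part of
  \<^const>\<open>self_adjoint\<close>, through the single-valuedness in \<^const>\<open>linear_operator\<close>.\<close>

lemma Domain_perturbed_generator:
  "Domain (perturbed_generator \<Psi> \<nu> a) =
     {\<phi> + C *\<^sub>C psi_shift \<Psi> \<nu> a | \<phi> C. \<phi> \<in> V21 \<Psi> \<and> cont_rep \<phi> a = 0}"
  by (auto simp: perturbed_generator_def)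

end

theory Submission
  imports Defs
begin

text \<open>On the Fourier side the resolvent \<open>(\<A> - \<nu>)\<^sup>-\<^sup>1\<close> is multiplication by \<open>- 1 / (\<Psi> + \<nu>)\<close>,
  so it is bounded and symmetric, and evaluation at \<open>a\<close> becomes
  \<open>((\<A> - \<nu>)\<^sup>-\<^sup>1 h)(a) = - (h, g)\<close> with \<open>g = \<psi>\<^sub>\<nu>(\<cdot> - a)\<close>. Hence \<open>\<A>\<^sub>\<mu> - \<nu>\<close> maps
  \<open>(\<A> - \<nu>)\<^sup>-\<^sup>1 h + C g\<close> to \<open>h\<close>, where \<open>h\<close> ranges over the orthogonal complement of \<open>g\<close>.
  Such an operator is symmetric; its range is the full complement of its kernel, which leaves no
  room for a larger adjoint.

  Plancherel's theorem rests on two facts about Gaussians: weighting \<open>\<bar>ft k\<bar>\<^sup>2\<close> by a Gaussian gives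
  the upper bound \<open>2\<pi>\<parallel>k\<parallel>\<^sup>2\<close>, and inversion is checked on modulated Gaussians, which are total
  because finite measures are determined by their characteristic functions.\<close>

section \<open>The space \<open>L2\<close>\<close>

text \<open>\<open>fourier\<close> is a \<open>Lim\<close>, while \<open>cont_rep\<close> and
  \<open>generator\<close> are definite descriptions, so none of them can be used before existence
  and uniqueness are known. This is why completeness of \<open>L2\<close> and a Bessel inequality
  precede every statement about \<open>fourier\<close>, and why continuous representatives are
  identified as explicit inversion integrals. Two points lie outside the symmetric-operator
  argument. Single-valuedness rests on psi_nu(0) being nonzero: \<open>green\<close> does not vanish
  at the point a, so the two summands of the domain meet only in 0. The relation mu * psi_nu(0) = 1
  supplies this. Density has to survive the constraint phi(a) = 0. On the Fourier side the
  constraint is the vanishing of an integral against a character; a character has modulus 1 and the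
  line has infinite measure, so this functional is unbounded in the L2 norm, and its kernel is
  dense.\<close>

lemma L2_of_rep [simp]: "L2_of (rep_L2 u) = u"
  by (rule Quotient3_abs_rep[OF Quotient3_L2])

lemma square_integrable_rep: "square_integrable (rep_L2 u)"
  using Quotient3_rep_reflp[OF Quotient3_L2, of u] by (simp add: L2_rel_def)

lemma L2_cases: obtains f where "square_integrable f" "u = L2_of f"
  using square_integrable_rep L2_of_rep by metis

lemma L2_of_eq_iff:
  assumes "square_integrable f" "square_integrable g"
  shows "L2_of f = L2_of g \<longleftrightarrow> (AE x in lborel. f x = g x)"
  using Quotient3_rel[OF Quotient3_L2, of f g] assms by (auto simp: L2_rel_def)

lemma AE_rep_L2_of: "square_integrable f \<Longrightarrow> AE x in lborel. rep_L2 (L2_of f) x = f x"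
  using L2_of_eq_iff[OF square_integrable_rep, of f "L2_of f"] by simp

lemma L2_eq_iff: "u = v \<longleftrightarrow> (AE x in lborel. rep_L2 u x = rep_L2 v x)"
  using L2_of_eq_iff[OF square_integrable_rep square_integrable_rep, of u v] by simp

lemma square_integrable_measurable [measurable_dest]:
  "square_integrable f \<Longrightarrow> f \<in> borel_measurable lborel"
  by (simp add: square_integrable_def)

lemma rep_L2_measurable [measurable]: "rep_L2 u \<in> borel_measurable lborel"
  using square_integrable_rep by (rule square_integrable_measurable)

lemma square_integrable_minus: "square_integrable f \<Longrightarrow> square_integrable (\<lambda>x. - f x)"
  using square_integrable_scale[of f "-1"] by simp

lemma square_integrable_diff:
  "square_integrable f \<Longrightarrow> square_integrable g \<Longrightarrow> square_integrable (\<lambda>x. f x - g x)"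
  using square_integrable_add[of f "\<lambda>x. - g x"] square_integrable_minus[of g] by simp

lemma borel_measurable_cnj [measurable]: "cnj \<in> borel_measurable borel"
  by (intro borel_measurable_continuous_onI continuous_intros)

lemma square_integrable_cnj: "square_integrable f \<Longrightarrow> square_integrable (\<lambda>x. cnj (f x))"
  using measurable_compose[OF _ borel_measurable_cnj, of f lborel]
  by (auto simp: square_integrable_def)

lemma square_integrable_bound:
  assumes "square_integrable g" "f \<in> borel_measurable lborel"
    and "AE x in lborel. cmod (f x) \<le> c * cmod (g x)"
  shows "square_integrable f"
proof -
  have "integrable lborel (\<lambda>x. (cmod (f x))\<^sup>2)"
  proof (rule Bochner_Integration.integrable_bound)
    show "integrable lborel (\<lambda>x. (cmod (c * g x))\<^sup>2)"
      using square_integrable_scale[OF assms(1), of c] by (simp add: square_integrable_def)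
    show "AE x in lborel. norm ((cmod (f x))\<^sup>2) \<le> norm ((cmod (c * g x))\<^sup>2)"
      using assms(3)
    proof (rule eventually_mono)
      fix x assume "cmod (f x) \<le> c * cmod (g x)"
      also have "\<dots> \<le> cmod (c * g x)" by (simp add: norm_mult mult_right_mono)
      finally show "norm ((cmod (f x))\<^sup>2) \<le> norm ((cmod (c * g x))\<^sup>2)"
        by (simp add: power_mono)
    qed
  qed (use assms(2) in measurable)
  with assms(2) show ?thesis by (simp add: square_integrable_def)
qed

lemma L2_of_add:
  "square_integrable f \<Longrightarrow> square_integrable g \<Longrightarrow> L2_of f + L2_of g = L2_of (\<lambda>x. f x + g x)"
  by (simp add: plus_L2.abs_eq L2_rel_def)

lemma L2_of_uminus: "square_integrable f \<Longrightarrow> - L2_of f = L2_of (\<lambda>x. - f x)"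
  by (simp add: uminus_L2.abs_eq L2_rel_def)

lemma L2_of_diff:
  "square_integrable f \<Longrightarrow> square_integrable g \<Longrightarrow> L2_of f - L2_of g = L2_of (\<lambda>x. f x - g x)"
  by (simp add: minus_L2_def L2_of_add L2_of_uminus square_integrable_minus)

lemma L2_of_scaleC: "square_integrable f \<Longrightarrow> c *\<^sub>C L2_of f = L2_of (\<lambda>x. c * f x)"
  by (simp add: scaleC.abs_eq L2_rel_def)

lemma cinner_L2_of:
  "square_integrable f \<Longrightarrow> square_integrable g \<Longrightarrow>
    cinner (L2_of f) (L2_of g) = (LINT x|lborel. f x * cnj (g x))"
  by (simp add: cinner.abs_eq L2_rel_def)

lemma norm_L2_of:
  "square_integrable f \<Longrightarrow> (norm (L2_of f))\<^sup>2 = (LINT x|lborel. (cmod (f x))\<^sup>2)"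
  by (simp add: power2_norm_eq_inner inner_L2_def cinner_L2_of cinner_self_eq)

lemma nn_norm_L2_of:
  "square_integrable f \<Longrightarrow> (\<integral>\<^sup>+x. ennreal ((cmod (f x))\<^sup>2) \<partial>lborel) = ennreal ((norm (L2_of f))\<^sup>2)"
  by (simp add: norm_L2_of nn_integral_eq_integral square_integrable_def)

lemma square_integrableI_nn:
  assumes "f \<in> borel_measurable lborel" "(\<integral>\<^sup>+x. ennreal ((cmod (f x))\<^sup>2) \<partial>lborel) < \<infinity>"
  shows "square_integrable f"
  using assms by (auto simp: square_integrable_def intro!: integrableI_bounded)

text \<open>Fatou's lemma produces bounds on nonnegative integrals; here such a bound becomes square
  integrability and a norm estimate at once. Both completeness and the Bessel inequality end this
  way.\<close>

lemma norm_le_nn: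
  assumes "f \<in> borel_measurable lborel"
    and "(\<integral>\<^sup>+x. ennreal ((cmod (f x))\<^sup>2) \<partial>lborel) \<le> ennreal (c\<^sup>2)" "0 \<le> c"
  shows "square_integrable f" "norm (L2_of f) \<le> c"
proof -
  show f: "square_integrable f"
    using assms by (intro square_integrableI_nn) (auto intro: le_less_trans)
  have "(norm (L2_of f))\<^sup>2 \<le> c\<^sup>2"
    using assms(2) nn_norm_L2_of[OF f] by simp
  then show "norm (L2_of f) \<le> c" using assms(3) by (rule power2_le_imp_le)
qed

lemma scaleC_add: "c *\<^sub>C (u + v) = c *\<^sub>C u + c *\<^sub>C v"
  by transfer (auto simp: L2_rel_def ring_distribs intro!: square_integrable_add square_integrable_scale)

lemma scaleC_add_left: "(c + d) *\<^sub>C u = c *\<^sub>C u + d *\<^sub>C u"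
  by transfer (auto simp: L2_rel_def ring_distribs intro!: square_integrable_add square_integrable_scale)

lemma scaleC_scaleC: "c *\<^sub>C d *\<^sub>C u = (c * d) *\<^sub>C u"
  by transfer (auto simp: L2_rel_def mult.assoc intro!: square_integrable_scale)

lemma scaleC_one [simp]: "1 *\<^sub>C u = u"
  by transfer (auto simp: L2_rel_def)

lemma scaleC_zero_left [simp]: "0 *\<^sub>C u = 0"
  by transfer (auto simp: L2_rel_def square_integrable_zero)

lemma scaleC_zero_right [simp]: "c *\<^sub>C (0::L2) = 0"
  by transfer (auto simp: L2_rel_def square_integrable_zero)

lemma scaleC_minus1: "(- 1) *\<^sub>C u = - u"
  by transfer (auto simp: L2_rel_def square_integrable_minus)

lemma scaleC_of_real: "of_real r *\<^sub>C u = r *\<^sub>R u"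
  by transfer (auto simp: L2_rel_def square_integrable_scale)

lemma cinner_add_left: "cinner (u + v) w = cinner u w + cinner v w"
  by transfer (simp add: L2_rel_def ring_distribs square_integrable_mult)

lemma cinner_commute: "cinner u v = cnj (cinner v u)"
  by transfer (subst Bochner_Integration.integral_cnj [symmetric], simp add: mult.commute)

lemma cinner_scaleC_left: "cinner (c *\<^sub>C u) v = c * cinner u v"
  by transfer (simp add: mult.assoc)

lemma cinner_add_right: "cinner u (v + w) = cinner u v + cinner u w"
  using cinner_add_left cinner_commute by (metis complex_cnj_add)

lemma cinner_scaleC_right: "cinner u (c *\<^sub>C v) = cnj c * cinner u v"
  using cinner_scaleC_left cinner_commute by (metis complex_cnj_mult)

lemma cinner_zero [simp]: "cinner 0 v = 0" "cinner v 0 = 0"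
  using cinner_scaleC_left[of 0 0 v] cinner_scaleC_right[of v 0 0] by simp_all

lemma cinner_diff_left: "cinner (u - v) w = cinner u w - cinner v w"
  using cinner_add_left[of u "- v" w] cinner_scaleC_left[of "- 1" v w] by (simp add: scaleC_minus1)

lemma cinner_diff_right: "cinner u (v - w) = cinner u v - cinner u w"
  using cinner_add_right[of u v "- w"] cinner_scaleC_right[of u "- 1" w] by (simp add: scaleC_minus1)

lemma cinner_self_eq_norm: "cinner u u = of_real ((norm u)\<^sup>2)"
  by (cases u rule: L2_cases) (simp add: cinner_L2_of norm_L2_of cinner_self_eq)

lemma cinner_self_eq_0_iff [simp]: "cinner u u = 0 \<longleftrightarrow> u = 0"
  by (simp add: cinner_self_eq_norm)

lemma norm_scaleC: "norm (c *\<^sub>C u) = cmod c * norm u"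
proof -
  have "(of_real ((norm (c *\<^sub>C u))\<^sup>2) :: complex) = (c * cnj c) * cinner u u"
    by (simp only: cinner_self_eq_norm[symmetric] cinner_scaleC_left cinner_scaleC_right mult_ac)
  also have "\<dots> = of_real ((cmod c * norm u)\<^sup>2)"
    by (simp add: cinner_self_eq_norm power_mult_distrib complex_norm_square[symmetric])
  finally have "(norm (c *\<^sub>C u))\<^sup>2 = (cmod c * norm u)\<^sup>2" by (simp only: of_real_eq_iff)
  then show ?thesis by (rule power2_eq_imp_eq) auto
qed

text \<open>Reduces continuity of \<open>cinner\<close> to that of the real inner product. The
  imaginary part is right because moving \<open>\<i>\<close> out of the second slot multiplies by
  \<open>- \<i>\<close>.\<close>

lemma cinner_eq_Complex: "cinner u v = Complex (inner u v) (inner u (\<i> *\<^sub>C v))"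
  by (simp add: complex_eq_iff inner_L2_def cinner_scaleC_right)

lemma bounded_linear_scaleC: "bounded_linear (\<lambda>u. c *\<^sub>C u)"
proof (rule bounded_linear_intro[where K = "cmod c"])
  show "c *\<^sub>C (r *\<^sub>R u) = r *\<^sub>R c *\<^sub>C u" for r u
    by (simp add: scaleC_of_real[symmetric] scaleC_scaleC mult.commute)
qed (simp_all add: scaleC_add norm_scaleC mult.commute)

lemmas tendsto_scaleC = bounded_linear.tendsto[OF bounded_linear_scaleC]

lemma tendsto_cinner:
  assumes "(f \<longlongrightarrow> u) F" "(g \<longlongrightarrow> v) F"
  shows "((\<lambda>x. cinner (f x) (g x)) \<longlongrightarrow> cinner u v) F"
  unfolding cinner_eq_Complex by (intro tendsto_intros assms tendsto_scaleC)

text \<open>Turns the sesquilinear \<open>cinner\<close> into the bilinear pairing that occurs in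
  the multiplication formula, and reverses the sign of the exponent in the Fourier integral.\<close>

lift_definition conj_L2 :: "L2 \<Rightarrow> L2" is "\<lambda>f x. cnj (f x)"
  by (auto simp: L2_rel_def intro: square_integrable_cnj)

lemma conj_L2_of: "square_integrable f \<Longrightarrow> conj_L2 (L2_of f) = L2_of (\<lambda>x. cnj (f x))"
  by (simp add: conj_L2.abs_eq L2_rel_def)

lemma conj_conj_L2 [simp]: "conj_L2 (conj_L2 u) = u"
  by transfer (simp add: L2_rel_def)

lemma cinner_conj: "cinner (conj_L2 u) (conj_L2 v) = cinner v u"
  by transfer (simp add: mult.commute)

lemma norm_conj_L2 [simp]: "norm (conj_L2 u) = norm u"
  using cinner_conj[of u u] by (simp add: cinner_self_eq_norm) (simp flip: of_real_power)

lemma conj_L2_diff: "conj_L2 (u - v) = conj_L2 u - conj_L2 v"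
  unfolding minus_L2_def
  by transfer (auto simp: L2_rel_def intro!: square_integrable_cnj square_integrable_diff)

lemma conj_L2_scaleC: "conj_L2 (c *\<^sub>C u) = cnj c *\<^sub>C conj_L2 u"
  by transfer (auto simp: L2_rel_def intro!: square_integrable_cnj square_integrable_scale)

lemma tendsto_conj_L2:
  assumes "(f \<longlongrightarrow> u) F"
  shows "((\<lambda>x. conj_L2 (f x)) \<longlongrightarrow> conj_L2 u) F"
  using assms unfolding tendsto_iff dist_norm conj_L2_diff[symmetric] by simp

text \<open>The Riesz-Fischer theorem. It provides the limit of the transforms of an approximating
  sequence, hence the existence of the limit in \<open>fourier\<close>.\<close>

instance L2 :: complete_space
proof
  fix X :: "nat \<Rightarrow> L2" assume "Cauchy X"
  then have "\<exists>N. \<forall>m\<ge>N. \<forall>n\<ge>N. norm (X m - X n) < (1/4)^k" for k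
    by (simp add: Cauchy_iff)
  then obtain N where N: "\<And>k m n. m \<ge> N k \<Longrightarrow> n \<ge> N k \<Longrightarrow> norm (X m - X n) < (1/4)^k"
    by metis
  \<comment> \<open>Partial sums dominate every earlier \<open>N i\<close>, so \<open>r j\<close> is
    a valid index for all levels up to \<open>j\<close> even if \<open>N\<close> is not
    monotone.\<close>
  define r where "r k = (\<Sum>i\<le>k. N i)" for k
  have rN: "N k \<le> r j" if "k \<le> j" for k j
    unfolding r_def using that by (intro member_le_sum) auto
  define f where "f k = rep_L2 (X (r k))" for k
  have f [simp]: "square_integrable (f k)" for k
    by (simp add: f_def square_integrable_rep)
  have [measurable]: "f k \<in> borel_measurable lborel" for k
    by (simp add: f_def)
  have [simp]: "L2_of (f k) = X (r k)" for k by (simp add: f_def)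
  \<comment> \<open>The squared step is at most 16^-k in norm, so the weight 4^k still leaves a
    summable series. Where the weighted series is finite, with sum C, each step is at most sqrt C *
    2^-k, which gives pointwise convergence.\<close>
  have step: "(\<integral>\<^sup>+x. ennreal (4^k * (cmod (f (Suc k) x - f k x))\<^sup>2) \<partial>lborel) \<le> ennreal ((1/4)^k)" for k
  proof -
    have "(\<integral>\<^sup>+x. ennreal (4^k * (cmod (f (Suc k) x - f k x))\<^sup>2) \<partial>lborel)
      = ennreal (4^k) * (\<integral>\<^sup>+x. ennreal ((cmod (f (Suc k) x - f k x))\<^sup>2) \<partial>lborel)"
      by (simp add: ennreal_mult nn_integral_cmult)
    also have "\<dots> = ennreal (4^k * (norm (X (r (Suc k)) - X (r k)))\<^sup>2)"
      by (simp add: nn_norm_L2_of square_integrable_diff ennreal_mult L2_of_diff[symmetric])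
    also have "\<dots> \<le> ennreal (4^k * ((1/4)^k)\<^sup>2)"
      using N[OF rN rN, of k "Suc k" k] by (intro ennreal_leI mult_left_mono power_mono) auto
    also have "4^k * ((1/4)^k)\<^sup>2 = ((1/4)^k :: real)"
      by (simp add: power2_eq_square power_mult_distrib[symmetric] mult.assoc[symmetric])
    finally show ?thesis .
  qed
  have "(\<integral>\<^sup>+x. (\<Sum>k. ennreal (4^k * (cmod (f (Suc k) x - f k x))\<^sup>2)) \<partial>lborel)
      = (\<Sum>k. \<integral>\<^sup>+x. ennreal (4^k * (cmod (f (Suc k) x - f k x))\<^sup>2) \<partial>lborel)"
    by (intro nn_integral_suminf) measurable
  also have "\<dots> \<le> (\<Sum>k. ennreal ((1/4)^k))"
    by (intro suminf_le step) auto
  also have "\<dots> = ennreal (\<Sum>k. (1/4)^k)"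
    by (intro suminf_ennreal2) (auto intro: summable_geometric)
  also have "\<dots> < \<infinity>" by simp
  finally have "AE x in lborel. (\<Sum>k. ennreal (4^k * (cmod (f (Suc k) x - f k x))\<^sup>2)) \<noteq> \<infinity>"
    by (intro nn_integral_noteq_infinite) auto
  then have conv: "AE x in lborel. convergent (\<lambda>k. f k x)"
  proof (rule eventually_mono)
    fix x assume fin: "(\<Sum>k. ennreal (4^k * (cmod (f (Suc k) x - f k x))\<^sup>2)) \<noteq> \<infinity>"
    define C where "C = enn2real (\<Sum>k. ennreal (4^k * (cmod (f (Suc k) x - f k x))\<^sup>2))"
    have C0: "0 \<le> C" by (simp add: C_def)
    have "cmod (f (Suc k) x - f k x) \<le> sqrt C * (1/2)^k" for k
    proof -
      have four: "(2^k)\<^sup>2 = (4^k :: real)"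
        by (simp add: power2_eq_square flip: power_mult_distrib)
      have "ennreal (4^k * (cmod (f (Suc k) x - f k x))\<^sup>2) \<le> ennreal C"
      proof -
        have "(\<Sum>i\<in>{k}. ennreal (4^i * (cmod (f (Suc i) x - f i x))\<^sup>2))
          \<le> (\<Sum>i. ennreal (4^i * (cmod (f (Suc i) x - f i x))\<^sup>2))"
          by (intro sum_le_suminf) auto
        then show ?thesis using fin by (simp add: C_def less_top)
      qed
      then have "4^k * (cmod (f (Suc k) x - f k x))\<^sup>2 \<le> C" using C0 by simp
      then have "(2^k * cmod (f (Suc k) x - f k x))\<^sup>2 \<le> C"
        by (simp add: power_mult_distrib four)
      then have "2^k * cmod (f (Suc k) x - f k x) \<le> sqrt C"
        by (rule real_le_rsqrt)
      then show ?thesis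
        by (simp add: power_one_over pos_le_divide_eq mult.commute)
    qed
    moreover have "summable (\<lambda>k. sqrt C * (1/2)^k)"
      by (intro summable_mult summable_geometric) simp
    ultimately have "summable (\<lambda>k. f (Suc k) x - f k x)"
      by (rule summable_comparison_test'[rotated, where N = 0])
    then have "convergent (\<lambda>n. \<Sum>k<n. f (Suc k) x - f k x)"
      by (simp add: summable_iff_convergent)
    then have "convergent (\<lambda>n. f n x - f 0 x)" 
      by (simp only: sum_lessThan_telescope[of "\<lambda>k. f k x"])
    then have "convergent (\<lambda>n. (f n x - f 0 x) + f 0 x)"
      by (intro convergent_add) (auto simp: convergent_const)
    then show "convergent (\<lambda>k. f k x)" by simp
  qed
  define F where "F x = lim (\<lambda>k. f k x)" for x
  have F [measurable]: "F \<in> borel_measurable lborel" unfolding F_def by measurable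
  \<comment> \<open>Fatou is applied with \<open>X n\<close> fixed and only the subsequence index
    \<open>j\<close> going to infinity. The estimate therefore concerns the original sequence, and
    no passage back from the subsequence is needed.\<close>
  have bound: "square_integrable (\<lambda>x. rep_L2 (X n) x - F x) \<and>
      norm (L2_of (\<lambda>x. rep_L2 (X n) x - F x)) \<le> (1/4)^k" if n: "n \<ge> N k" for n k
  proof -
    have "(\<integral>\<^sup>+x. ennreal ((cmod (rep_L2 (X n) x - F x))\<^sup>2) \<partial>lborel)
      = (\<integral>\<^sup>+x. liminf (\<lambda>j. ennreal ((cmod (rep_L2 (X n) x - f j x))\<^sup>2)) \<partial>lborel)"
    proof (rule nn_integral_cong_AE, rule eventually_mono[OF conv])
      fix x assume "convergent (\<lambda>k. f k x)"
      then have "(\<lambda>j. f j x) \<longlonglongrightarrow> F x" by (simp add: F_def convergent_LIMSEQ_iff)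
      then have "(\<lambda>j. ennreal ((cmod (rep_L2 (X n) x - f j x))\<^sup>2))
          \<longlonglongrightarrow> ennreal ((cmod (rep_L2 (X n) x - F x))\<^sup>2)"
        by (intro tendsto_ennrealI tendsto_intros)
      then show "ennreal ((cmod (rep_L2 (X n) x - F x))\<^sup>2)
          = liminf (\<lambda>j. ennreal ((cmod (rep_L2 (X n) x - f j x))\<^sup>2))"
        by (rule lim_imp_Liminf[OF sequentially_bot, symmetric])
    qed
    also have "\<dots> \<le> liminf (\<lambda>j. \<integral>\<^sup>+x. ennreal ((cmod (rep_L2 (X n) x - f j x))\<^sup>2) \<partial>lborel)"
      by (intro nn_integral_liminf) measurable
    also have "\<dots> \<le> liminf (\<lambda>j::nat. ennreal (((1/4)^k)\<^sup>2))"
    proof (rule Liminf_mono, rule eventually_sequentiallyI[of k])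
      fix j assume "k \<le> j"
      have "(\<integral>\<^sup>+x. ennreal ((cmod (rep_L2 (X n) x - f j x))\<^sup>2) \<partial>lborel) = ennreal ((norm (X n - X (r j)))\<^sup>2)"
        by (simp add: nn_norm_L2_of square_integrable_diff square_integrable_rep L2_of_diff[symmetric])
      also have "\<dots> \<le> ennreal (((1/4)^k)\<^sup>2)"
        using N[OF n rN[OF \<open>k \<le> j\<close>]] by (intro ennreal_leI power_mono) auto
      finally show "(\<integral>\<^sup>+x. ennreal ((cmod (rep_L2 (X n) x - f j x))\<^sup>2) \<partial>lborel) \<le> ennreal (((1/4)^k)\<^sup>2)" .
    qed
    also have "\<dots> = ennreal (((1/4)^k)\<^sup>2)" by (simp add: Liminf_const)
    finally show ?thesis by (intro conjI norm_le_nn) auto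
  qed
  have sF: "square_integrable F"
    using square_integrable_diff[OF square_integrable_rep[of "X (N 0)"] conjunct1[OF bound[of 0 "N 0"]]] by simp
  have le: "norm (X n - L2_of F) \<le> (1/4)^k" if "n \<ge> N k" for n k
    using conjunct2[OF bound[OF that]] L2_of_diff[OF square_integrable_rep[of "X n"] sF] by simp
  have "X \<longlonglongrightarrow> L2_of F"
  proof (rule metric_LIMSEQ_I)
    fix e :: real assume "e > 0"
    then obtain k where "(1/4)^k < e" using real_arch_pow_inv[of e "1/4"] by auto
    then show "\<exists>no. \<forall>n\<ge>no. dist (X n) (L2_of F) < e"
      unfolding dist_norm using le by (meson le_less_trans)
  qed
  then show "convergent X" by (rule convergentI)
qed

section \<open>Fourier transform of integrable functions\<close>

definition ft :: "(real \<Rightarrow> complex) \<Rightarrow> real \<Rightarrow> complex" where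
  "ft f p = (LINT x|lborel. exp (\<i> * of_real (p * x)) * f x)"

lemma norm_iexp [simp]: "norm (exp (\<i> * complex_of_real x)) = 1"
  by (simp add: norm_exp_eq_Re)

lemma integrable_iexp_mult:
  assumes "integrable lborel f"
  shows "integrable lborel (\<lambda>x. exp (\<i> * complex_of_real (p * x)) * f x)"
proof (rule Bochner_Integration.integrable_bound[OF assms])
  have [measurable]: "f \<in> borel_measurable lborel" using assms by auto
  show "(\<lambda>x. exp (\<i> * complex_of_real (p * x)) * f x) \<in> borel_measurable lborel"
    by measurable
qed (simp only: norm_mult norm_iexp, simp)

lemma ft_norm_le: "cmod (ft f p) \<le> (LINT x|lborel. cmod (f x))"
  unfolding ft_def
  by (rule order.trans[OF integral_norm_bound]) (simp only: norm_mult norm_iexp, simp)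

lemma continuous_on_ft:
  assumes "integrable lborel f"
  shows "continuous_on S (ft f)"
proof -
  have [measurable]: "f \<in> borel_measurable lborel" using assms by auto
  have "isCont (ft f) t" for t
    unfolding continuous_at_sequentially
  proof safe
    fix X assume X: "X \<longlonglongrightarrow> t"
    show "(ft f \<circ> X) \<longlonglongrightarrow> ft f t"
      unfolding comp_def ft_def
    proof (rule integral_dominated_convergence[where w="\<lambda>x. norm (f x)"])
      show "AE x in lborel. (\<lambda>i. exp (\<i> * complex_of_real (X i * x)) * f x)
          \<longlonglongrightarrow> exp (\<i> * complex_of_real (t * x)) * f x"
        by (intro AE_I2 tendsto_intros X)
    next
      show "AE x in lborel. norm (exp (\<i> * complex_of_real (X i * x)) * f x) \<le> norm (f x)" for i
        unfolding norm_mult norm_iexp by simp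
    qed (use assms in \<open>auto intro!: borel_measurable_integrable integrable_iexp_mult\<close>)
  qed
  then show ?thesis by (simp add: continuous_at_imp_continuous_on)
qed

lemma borel_measurable_ft: "integrable lborel f \<Longrightarrow> ft f \<in> borel_measurable borel"
  by (intro borel_measurable_continuous_onI continuous_on_ft)

lemma integrable_bounded_mult:
  fixes f g :: "real \<Rightarrow> complex"
  assumes "integrable lborel g" "f \<in> borel_measurable lborel" "\<And>x. cmod (f x) \<le> C"
  shows "integrable lborel (\<lambda>x. f x * g x)"
proof (rule Bochner_Integration.integrable_bound)
  have [measurable]: "f \<in> borel_measurable lborel" "g \<in> borel_measurable lborel"
    using assms by auto
  show "integrable lborel (\<lambda>x. C * cmod (g x))" using assms by auto
  show "(\<lambda>x. f x * g x) \<in> borel_measurable lborel" by measurable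
  show "AE x in lborel. norm (f x * g x) \<le> norm (C * cmod (g x))"
  proof (rule AE_I2)
    fix x
    have "norm (f x * g x) \<le> C * cmod (g x)"
      by (simp add: norm_mult mult_right_mono assms)
    then show "norm (f x * g x) \<le> norm (C * cmod (g x))" by simp
  qed
qed

lemma integrable_ft_mult:
  assumes "integrable lborel f" "integrable lborel g"
  shows "integrable lborel (\<lambda>p. ft f p * g p)"
  using assms borel_measurable_ft[OF assms(1)]
  by (intro integrable_bounded_mult[where f = "ft f", OF _ _ ft_norm_le]) auto

text \<open>Fubini for a kernel of modulus 1 against the product of two integrable functions. No
  conjugation occurs, so a transform can be moved to the other factor as it stands.\<close>

lemma ft_multiplication_formula:
  assumes f: "integrable lborel f" and g: "integrable lborel g"
  shows "(LINT p|lborel. ft f p * g p) = (LINT x|lborel. f x * ft g x)"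
proof -
  have [measurable]: "f \<in> borel_measurable borel" "g \<in> borel_measurable borel"
    using assms by auto
  have "integrable (lborel \<Otimes>\<^sub>M lborel)
      (\<lambda>(x, p). exp (\<i> * complex_of_real (p * x)) * f x * g p)"
  proof (rule lborel_pair.Fubini_integrable)
    show "(\<lambda>(x, p). exp (\<i> * complex_of_real (p * x)) * f x * g p)
        \<in> borel_measurable (lborel \<Otimes>\<^sub>M lborel)" by measurable
    show "integrable lborel (\<lambda>x. LINT p|lborel. norm (case (x, p) of (x, p) \<Rightarrow>
        exp (\<i> * complex_of_real (p * x)) * f x * g p))"
      unfolding split_conv norm_mult norm_iexp using f g by simp
    show "AE x in lborel. integrable lborel (\<lambda>p. case (x, p) of (x, p) \<Rightarrow>
        exp (\<i> * complex_of_real (p * x)) * f x * g p)"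
      unfolding split_conv
    proof (rule AE_I2)
      fix x
      have "integrable lborel (\<lambda>p. f x * (exp (\<i> * complex_of_real (x * p)) * g p))"
        by (intro integrable_mult_right integrable_iexp_mult g)
      then show "integrable lborel (\<lambda>p. exp (\<i> * complex_of_real (p * x)) * f x * g p)"
        by (simp add: mult_ac)
    qed
  qed
  from lborel_pair.Fubini_integral[OF this]
  have "(LINT p|lborel. LINT x|lborel. exp (\<i> * complex_of_real (p * x)) * f x * g p)
    = (LINT x|lborel. LINT p|lborel. f x * (exp (\<i> * complex_of_real (x * p)) * g p))"
    by (simp add: mult_ac)
  then show ?thesis by (simp add: ft_def)
qed

section \<open>Gaussians and the Bessel inequality\<close>

lemma ft_std_gaussian:
  "ft (\<lambda>x. of_real (exp (- x\<^sup>2 / 2))) p = of_real (sqrt (2 * pi) * exp (- p\<^sup>2 / 2))"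
proof -
  have "of_real (exp (- p\<^sup>2 / 2)) = char std_normal_distribution p"
    by (simp add: char_std_normal_distribution)
  also have "\<dots> = (LINT x|lborel. std_normal_density x *\<^sub>R exp (\<i> * complex_of_real (p * x)))"
    unfolding char_def by (subst integral_density) auto
  also have "\<dots> = (LINT x|lborel. of_real (1 / sqrt (2 * pi)) *
      (exp (\<i> * complex_of_real (p * x)) * of_real (exp (- x\<^sup>2 / 2))))"
    by (intro Bochner_Integration.integral_cong) (simp_all add: std_normal_density_def scaleR_conv_of_real)
  also have "\<dots> = of_real (1 / sqrt (2 * pi)) * ft (\<lambda>x. of_real (exp (- x\<^sup>2 / 2))) p"
    by (simp add: ft_def)
  finally show ?thesis by (simp add: field_simps)
qed

text \<open>A rescaling of the standard case. The result is expressed through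
  \<open>normal_density\<close> because its mass 1 isolates the factor 2 pi, which becomes the
  constant of Plancherel's theorem.\<close>

lemma ft_gaussian:
  assumes "0 < s"
  shows "ft (\<lambda>x. of_real (exp (- (s * x)\<^sup>2 / 2))) p = of_real (2 * pi * normal_density 0 s p)"
proof -
  have "ft (\<lambda>x. of_real (exp (- x\<^sup>2 / 2))) (p / s) =
      \<bar>s\<bar> *\<^sub>R (LINT x|lborel. exp (\<i> * complex_of_real (p / s * (0 + s * x))) * of_real (exp (- (0 + s * x)\<^sup>2 / 2)))"
    unfolding ft_def using assms by (intro lborel_integral_real_affine) simp
  then have *: "ft (\<lambda>x. of_real (exp (- x\<^sup>2 / 2))) (p / s) =
      of_real s * ft (\<lambda>x. of_real (exp (- (s * x)\<^sup>2 / 2))) p"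
    using assms by (simp add: ft_def scaleR_conv_of_real)
  have "sqrt (2 * pi) * sqrt (2 * pi) = 2 * pi" by simp
  then have "2 * pi * (1 / (sqrt (2 * pi) * s)) = sqrt (2 * pi) / s"
    using assms by (simp add: field_simps)
  then have "2 * pi * normal_density 0 s p = sqrt (2 * pi) * exp (- (p / s)\<^sup>2 / 2) / s"
    using assms by (simp add: normal_density_def real_sqrt_mult power_divide field_simps)
  moreover have "ft (\<lambda>x. of_real (exp (- (s * x)\<^sup>2 / 2))) p
      = of_real (sqrt (2 * pi) * exp (- (p / s)\<^sup>2 / 2) / s)"
  proof -
    have "F = of_real (X / s)" if "of_real X = of_real s * F" for F :: complex and X :: real
      using that assms by (simp add: field_simps)
    then show ?thesis using * unfolding ft_std_gaussian by blast
  qed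
  ultimately show ?thesis by simp
qed

lemma integrable_gaussian:
  assumes "0 < s"
  shows "integrable lborel (\<lambda>x. complex_of_real (exp (- (s * x)\<^sup>2 / 2)))"
proof -
  have "exp (- (s * x)\<^sup>2 / 2) = (sqrt (2 * pi * (1/s)\<^sup>2)) * normal_density 0 (1/s) x" for x
    using assms by (simp add: normal_density_def power_mult_distrib field_simps)
  moreover have "integrable lborel (\<lambda>x. (sqrt (2 * pi * (1/s)\<^sup>2)) * normal_density 0 (1/s) x)"
    using assms by simp
  ultimately have "integrable lborel (\<lambda>x. exp (- (s * x)\<^sup>2 / 2))" by simp
  then show ?thesis by (rule integrable_of_real)
qed

lemma nn_integral_normal_density:
  assumes "0 < s"
  shows "(\<integral>\<^sup>+y. ennreal (normal_density x s y) \<partial>lborel) = 1"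
  using assms by (simp add: nn_integral_eq_integral)

lemma normal_density_commute: "normal_density x s y = normal_density y s x"
  by (simp add: normal_density_def power2_commute)

lemma normal_density_shift: "normal_density 0 s (y - x) = normal_density x s y"
  by (simp add: normal_density_def)

text \<open>A non-integrable \<open>f\<close> has Bochner integral 0, so the bound covers that case
  too, and nested integrals can be estimated before their convergence is known.\<close>

lemma norm_integral_le_nn:
  fixes f :: "'a \<Rightarrow> 'b::{banach, second_countable_topology}"
  shows "ennreal (norm (integral\<^sup>L M f)) \<le> (\<integral>\<^sup>+x. ennreal (norm (f x)) \<partial>M)"
  by (cases "integrable M f") (auto simp: integral_norm_bound_ennreal not_integrable_integral_eq)

lemma ft_cnj: "ft (\<lambda>x. cnj (f x)) p = cnj (ft f (- p))"
  unfolding ft_def by (subst Bochner_Integration.integral_cnj[symmetric]) (simp add: exp_cnj)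

lemma ft_cmult: "ft (\<lambda>x. c * f x) p = c * ft f p"
  unfolding ft_def by (subst integral_mult_right_zero[symmetric]) (simp only: mult_ac)

lemma ft_add:
  assumes "integrable lborel f" "integrable lborel g"
  shows "ft (\<lambda>x. f x + g x) p = ft f p + ft g p"
  unfolding ft_def ring_distribs
  by (intro Bochner_Integration.integral_add integrable_iexp_mult assms)

text \<open>The multiplication formula is used twice: once to take the transform off the first
  \<open>k\<close>, once to evaluate the transform of the weighted conjugate as a Gaussian average
  of \<open>cnj (k y)\<close> around \<open>x\<close>.\<close>

lemma gaussian_weighted_ft_identity:
  assumes k: "integrable lborel k" and s: "0 < s"
  shows "(LINT p|lborel. ft k p * (of_real (exp (- (s * p)\<^sup>2 / 2)) * cnj (ft k p)))
    = (LINT x|lborel. k x * (LINT y|lborel. of_real (2 * pi * normal_density x s y) * cnj (k y)))"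
proof -
  let ?w = "\<lambda>p. complex_of_real (exp (- (s * p)\<^sup>2 / 2))"
  note [measurable] = borel_measurable_ft[OF k]
  have w: "integrable lborel ?w" by (rule integrable_gaussian[OF s])
  have "integrable lborel (\<lambda>p. cnj (ft k p) * ?w p)"
    by (intro integrable_bounded_mult[where C = "LINT x|lborel. cmod (k x)"] w) (simp_all add: ft_norm_le)
  then have 1: "integrable lborel (\<lambda>p. ?w p * cnj (ft k p))" by (simp add: mult.commute)
  have "ft (\<lambda>p. ?w p * cnj (ft k p)) x
      = (LINT y|lborel. of_real (2 * pi * normal_density x s y) * cnj (k y))" for x
  proof -
    have 2: "integrable lborel (\<lambda>p. exp (\<i> * complex_of_real (- x * p)) * ?w p)"
      by (intro integrable_iexp_mult w)
    have shift: "ft (\<lambda>p. exp (\<i> * complex_of_real (- x * p)) * ?w p) y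
        = of_real (2 * pi * normal_density x s y)" for y
    proof -
      have "exp (\<i> * complex_of_real (y * p)) * exp (\<i> * complex_of_real (- x * p))
          = exp (\<i> * complex_of_real ((y - x) * p))" for p
        unfolding exp_add[symmetric] by (simp add: algebra_simps)
      then have "ft (\<lambda>p. exp (\<i> * complex_of_real (- x * p)) * ?w p) y = ft ?w (y - x)"
        by (simp only: ft_def mult.assoc[symmetric])
      then show ?thesis by (simp only: ft_gaussian[OF s] normal_density_shift)
    qed
    have "ft (\<lambda>p. ?w p * cnj (ft k p)) x
        = cnj (LINT p|lborel. ft k p * (exp (\<i> * complex_of_real (- x * p)) * ?w p))"
      unfolding ft_def[of _ x]
      by (subst Bochner_Integration.integral_cnj[symmetric]) (simp add: exp_cnj mult_ac)
    also have "\<dots> = cnj (LINT y|lborel. k y * of_real (2 * pi * normal_density x s y))"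
      by (simp only: ft_multiplication_formula[OF k 2] shift)
    also have "\<dots> = (LINT y|lborel. of_real (2 * pi * normal_density x s y) * cnj (k y))"
      by (subst Bochner_Integration.integral_cnj[symmetric]) (simp add: mult_ac)
    finally show ?thesis .
  qed
  then show ?thesis by (simp only: ft_multiplication_formula[OF k 1])
qed

text \<open>Schur's test for the Gaussian kernel: 2 |k x| |k y| is at most |k x|^2 + |k y|^2, and
  the kernel is symmetric with mass 1 in each variable, so each square contributes pi times the
  squared norm. The bound is uniform in \<open>s\<close>.\<close>

lemma bessel_gaussian_weight:
  assumes k: "integrable lborel k" and sq: "square_integrable k" and s: "0 < s"
  shows "(\<integral>\<^sup>+p. ennreal ((cmod (ft k p))\<^sup>2 * exp (- (s * p)\<^sup>2 / 2)) \<partial>lborel)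
    \<le> ennreal (2 * pi * (norm (L2_of k))\<^sup>2)"
proof -
  let ?w = "\<lambda>p. exp (- (s * p)\<^sup>2 / 2)"
  let ?N = "\<lambda>x y. normal_density x s y"
  note [measurable] = borel_measurable_ft[OF k]
  have [measurable]: "k \<in> borel_measurable borel" using k by auto
  have N [measurable]: "(\<lambda>(x, y). ?N x y) \<in> borel_measurable (lborel \<Otimes>\<^sub>M lborel)"
    unfolding normal_density_def by measurable
  have eq: "ft k p * (of_real (?w p) * cnj (ft k p)) = of_real ((cmod (ft k p))\<^sup>2 * ?w p)" for p
    using complex_norm_square[of "ft k p"] by (simp add: mult_ac)
  have "integrable lborel (\<lambda>p. cnj (ft k p) * of_real (?w p))"
    by (intro integrable_bounded_mult[where C = "LINT x|lborel. cmod (k x)"] integrable_gaussian s)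
       (simp_all add: ft_norm_le)
  then have "integrable lborel (\<lambda>p. ft k p * (of_real (?w p) * cnj (ft k p)))"
    using k by (intro integrable_ft_mult k) (simp add: mult.commute)
  then have int: "integrable lborel (\<lambda>p. (cmod (ft k p))\<^sup>2 * ?w p)"
    unfolding eq by (simp only: complex_of_real_integrable_eq)
  have "(\<integral>\<^sup>+p. ennreal ((cmod (ft k p))\<^sup>2 * ?w p) \<partial>lborel)
      = ennreal (LINT p|lborel. (cmod (ft k p))\<^sup>2 * ?w p)"
    by (intro nn_integral_eq_integral int) simp
  also have "\<dots> = ennreal (cmod (LINT p|lborel. ft k p * (of_real (?w p) * cnj (ft k p))))"
    unfolding eq integral_complex_of_real by simp
  also have "\<dots> = ennreal (cmod (LINT x|lborel. k x * (LINT y|lborel. of_real (2 * pi * ?N x y) * cnj (k y))))"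
    by (simp only: gaussian_weighted_ft_identity[OF k s])
  also have "\<dots> \<le> (\<integral>\<^sup>+x. ennreal (cmod (k x * (LINT y|lborel. of_real (2 * pi * ?N x y) * cnj (k y)))) \<partial>lborel)"
    by (rule norm_integral_le_nn)
  also have "\<dots> \<le> (\<integral>\<^sup>+x. \<integral>\<^sup>+y. ennreal (cmod (k x) * (2 * pi * ?N x y * cmod (k y))) \<partial>lborel \<partial>lborel)"
  proof (rule nn_integral_mono)
    fix x
    have "ennreal (cmod (k x * (LINT y|lborel. of_real (2 * pi * ?N x y) * cnj (k y))))
      = ennreal (cmod (k x)) * ennreal (cmod (LINT y|lborel. of_real (2 * pi * ?N x y) * cnj (k y)))"
      by (simp add: norm_mult ennreal_mult)
    also have "\<dots> \<le> ennreal (cmod (k x)) * (\<integral>\<^sup>+y. ennreal (cmod (of_real (2 * pi * ?N x y) * cnj (k y))) \<partial>lborel)"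
      by (intro mult_left_mono norm_integral_le_nn) simp
    also have "\<dots> = (\<integral>\<^sup>+y. ennreal (cmod (k x) * (2 * pi * ?N x y * cmod (k y))) \<partial>lborel)"
      by (subst nn_integral_cmult[symmetric]) (simp_all add: norm_mult ennreal_mult[symmetric])
    finally show "ennreal (cmod (k x * (LINT y|lborel. of_real (2 * pi * ?N x y) * cnj (k y)))) \<le> \<dots>" .
  qed
  also have "\<dots> \<le> (\<integral>\<^sup>+x. \<integral>\<^sup>+y. ennreal (pi * (cmod (k x))\<^sup>2) * ennreal (?N x y)
      + ennreal (pi * (cmod (k y))\<^sup>2) * ennreal (?N x y) \<partial>lborel \<partial>lborel)"
  proof (intro nn_integral_mono)
    fix x y
    have "(2 * (cmod (k x) * cmod (k y))) * (pi * ?N x y) \<le> ((cmod (k x))\<^sup>2 + (cmod (k y))\<^sup>2) * (pi * ?N x y)"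
      using sum_squares_bound[of "cmod (k x)" "cmod (k y)"] by (intro mult_right_mono) auto
    then have "cmod (k x) * (2 * pi * ?N x y * cmod (k y))
        \<le> pi * (cmod (k x))\<^sup>2 * ?N x y + pi * (cmod (k y))\<^sup>2 * ?N x y"
      by (simp add: algebra_simps)
    then show "ennreal (cmod (k x) * (2 * pi * ?N x y * cmod (k y)))
      \<le> ennreal (pi * (cmod (k x))\<^sup>2) * ennreal (?N x y) + ennreal (pi * (cmod (k y))\<^sup>2) * ennreal (?N x y)"
      by (simp add: ennreal_mult[symmetric] ennreal_plus[symmetric] ennreal_leI del: ennreal_plus)
  qed
  also have "\<dots> = (\<integral>\<^sup>+x. \<integral>\<^sup>+y. ennreal (pi * (cmod (k x))\<^sup>2) * ennreal (?N x y) \<partial>lborel \<partial>lborel)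
      + (\<integral>\<^sup>+x. \<integral>\<^sup>+y. ennreal (pi * (cmod (k y))\<^sup>2) * ennreal (?N x y) \<partial>lborel \<partial>lborel)"
    by (subst nn_integral_add) (simp_all add: nn_integral_add)
  also have "(\<integral>\<^sup>+x. \<integral>\<^sup>+y. ennreal (pi * (cmod (k y))\<^sup>2) * ennreal (?N x y) \<partial>lborel \<partial>lborel)
      = (\<integral>\<^sup>+y. \<integral>\<^sup>+x. ennreal (pi * (cmod (k y))\<^sup>2) * ennreal (?N y x) \<partial>lborel \<partial>lborel)"
    by (subst lborel_pair.Fubini') (simp_all add: normal_density_commute[of _ s])
  also have "(\<integral>\<^sup>+x. \<integral>\<^sup>+y. ennreal (pi * (cmod (k x))\<^sup>2) * ennreal (?N x y) \<partial>lborel \<partial>lborel)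
      = (\<integral>\<^sup>+x. ennreal (pi * (cmod (k x))\<^sup>2) \<partial>lborel)"
    by (simp add: nn_integral_cmult nn_integral_normal_density[OF s])
  also have "\<dots> + \<dots> = (\<integral>\<^sup>+x. ennreal (2 * pi) * ennreal ((cmod (k x))\<^sup>2) \<partial>lborel)"
    by (subst nn_integral_add[symmetric])
       (simp_all add: ennreal_plus[symmetric] ennreal_mult[symmetric] mult.assoc del: ennreal_plus)
  also have "\<dots> = ennreal (2 * pi * (norm (L2_of k))\<^sup>2)"
    by (subst nn_integral_cmult) (simp_all add: nn_norm_L2_of[OF sq] ennreal_mult)
  finally show ?thesis .
qed

text \<open>Fatou's lemma as \<open>s\<close> tends to 0 along 1 / (n + 1), the weight tending to 1
  pointwise. Only an inequality results; equality comes later, from inversion.\<close>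

lemma bessel_ft:
  assumes k: "integrable lborel k" and sq: "square_integrable k"
  shows "square_integrable (ft k)" "norm (L2_of (ft k)) \<le> sqrt (2 * pi) * norm (L2_of k)"
proof -
  note [measurable] = borel_measurable_ft[OF k]
  have "(\<integral>\<^sup>+p. ennreal ((cmod (ft k p))\<^sup>2) \<partial>lborel)
    = (\<integral>\<^sup>+p. liminf (\<lambda>n. ennreal ((cmod (ft k p))\<^sup>2 * exp (- (inverse (real (Suc n)) * p)\<^sup>2 / 2))) \<partial>lborel)"
  proof (rule nn_integral_cong)
    fix p
    have "(\<lambda>n. ennreal ((cmod (ft k p))\<^sup>2 * exp (- (inverse (real (Suc n)) * p)\<^sup>2 / 2)))
      \<longlonglongrightarrow> ennreal ((cmod (ft k p))\<^sup>2 * exp (- (0 * p)\<^sup>2 / 2))"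
      by (intro tendsto_ennrealI tendsto_intros LIMSEQ_inverse_real_of_nat) simp
    then show "ennreal ((cmod (ft k p))\<^sup>2) =
        liminf (\<lambda>n. ennreal ((cmod (ft k p))\<^sup>2 * exp (- (inverse (real (Suc n)) * p)\<^sup>2 / 2)))"
      by (subst lim_imp_Liminf[OF sequentially_bot]) simp_all
  qed
  also have "\<dots> \<le> liminf (\<lambda>n. \<integral>\<^sup>+p. ennreal ((cmod (ft k p))\<^sup>2 * exp (- (inverse (real (Suc n)) * p)\<^sup>2 / 2)) \<partial>lborel)"
    by (intro nn_integral_liminf) measurable
  also have "\<dots> \<le> liminf (\<lambda>n::nat. ennreal (2 * pi * (norm (L2_of k))\<^sup>2))"
    by (intro Liminf_mono always_eventually allI bessel_gaussian_weight assms) simp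
  also have "\<dots> = ennreal ((sqrt (2 * pi) * norm (L2_of k))\<^sup>2)"
    by (simp add: Liminf_const power_mult_distrib)
  finally have le: "(\<integral>\<^sup>+p. ennreal ((cmod (ft k p))\<^sup>2) \<partial>lborel) \<le> \<dots>" .
  show "square_integrable (ft k)" "norm (L2_of (ft k)) \<le> sqrt (2 * pi) * norm (L2_of k)"
    by (rule norm_le_nn[OF _ le]; simp)+
qed

text \<open>The positive and negative parts of \<open>k\<close> have the same transform. Divided by
  their common mass they are probability densities with equal characteristic functions, so
  \<open>Levy_uniqueness\<close> identifies them; mass 0 is treated apart.\<close>

lemma ft_eq_0_imp_AE_real:
  fixes k :: "real \<Rightarrow> real"
  assumes k: "integrable lborel k" and z: "\<And>p. ft (\<lambda>x. of_real (k x)) p = 0"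
  shows "AE x in lborel. k x = 0"
proof -
  have [measurable]: "k \<in> borel_measurable borel" using k by auto
  define u v where "u x = max 0 (k x)" and "v x = max 0 (- k x)" for x
  have [measurable]: "u \<in> borel_measurable borel" "v \<in> borel_measurable borel"
    unfolding u_def v_def by measurable
  have kuv: "k x = u x - v x" for x by (simp add: u_def v_def max_def)
  have nonneg: "0 \<le> u x" "0 \<le> v x" for x by (simp_all add: u_def v_def)
  have u: "integrable lborel u" and v: "integrable lborel v"
    by (rule Bochner_Integration.integrable_bound[OF k]; simp add: u_def v_def max_def)+
  have "ft (\<lambda>x. of_real (k x)) p = ft (\<lambda>x. of_real (u x)) p - ft (\<lambda>x. of_real (v x)) p" for p
    unfolding ft_def kuv of_real_diff right_diff_distrib
    by (intro Bochner_Integration.integral_diff integrable_iexp_mult integrable_of_real u v)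
  then have eq: "ft (\<lambda>x. of_real (u x)) p = ft (\<lambda>x. of_real (v x)) p" for p using z by simp
  define c where "c = (LINT x|lborel. u x)"
  \<comment> \<open>At frequency 0 the transform is the total mass, so one constant normalises both
    parts.\<close>
  have cv: "(LINT x|lborel. v x) = c"
    using eq[of 0] by (simp add: ft_def c_def)
  have c0: "0 \<le> c" by (simp add: c_def nonneg)
  show ?thesis
  proof (cases "c = 0")
    case True
    have "AE x in lborel. u x = 0" "AE x in lborel. v x = 0"
      using True cv integral_nonneg_eq_0_iff_AE[OF u] integral_nonneg_eq_0_iff_AE[OF v]
      by (simp_all add: nonneg c_def)
    then show ?thesis by eventually_elim (simp add: kuv)
  next
    case False
    with c0 have c: "0 < c" by simp
    have distr: "real_distribution (density lborel (\<lambda>x. ennreal (g x / c)))"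
      if "integrable lborel g" "\<And>x. 0 \<le> g x" "(LINT x|lborel. g x) = c" for g
    proof -
      have [measurable]: "g \<in> borel_measurable borel" using that(1) by auto
      have "(\<integral>\<^sup>+x. ennreal (g x / c) \<partial>lborel) = ennreal (LINT x|lborel. g x / c)"
        using that c by (intro nn_integral_eq_integral) auto
      also have "\<dots> = 1" using that c by simp
      finally have "prob_space (density lborel (\<lambda>x. ennreal (g x / c)))"
        by (intro prob_spaceI) (simp add: emeasure_density)
      then show ?thesis
        by (auto simp: real_distribution_def real_distribution_axioms_def)
    qed
    have chr: "char (density lborel (\<lambda>x. ennreal (g x / c))) p = ft (\<lambda>x. of_real (g x)) p / of_real c"
      if "integrable lborel g" "\<And>x. 0 \<le> g x" for g p
    proof -
      have [measurable]: "g \<in> borel_measurable borel" using that(1) by auto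
      have "char (density lborel (\<lambda>x. ennreal (g x / c))) p
          = (LINT x|lborel. (g x / c) *\<^sub>R exp (\<i> * complex_of_real (p * x)))"
        unfolding char_def using that c by (subst integral_density) auto
      also have "\<dots> = (LINT x|lborel. exp (\<i> * complex_of_real (p * x)) * of_real (g x) / of_real c)"
        by (intro Bochner_Integration.integral_cong) (simp_all add: scaleR_conv_of_real)
      finally show ?thesis by (simp add: ft_def)
    qed
    have "density lborel (\<lambda>x. ennreal (u x / c)) = density lborel (\<lambda>x. ennreal (v x / c))"
      using distr[OF u nonneg(1)] distr[OF v nonneg(2)] cv eq
      by (intro Levy_uniqueness) (auto simp: c_def[symmetric] chr u v nonneg fun_eq_iff)
    then have "AE x in lborel. ennreal (u x / c) = ennreal (v x / c)"
      by (intro sigma_finite_measure.density_unique[OF lborel.sigma_finite_measure_axioms]) auto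
    then show ?thesis
      by eventually_elim (use c nonneg in \<open>simp add: kuv\<close>)
  qed
qed

text \<open>The transform of \<open>cnj k\<close> is the reflected conjugate of that of
  \<open>k\<close>, so it vanishes as well, and with it the transforms of the real and imaginary
  parts.\<close>

lemma ft_eq_0_imp_AE:
  assumes k: "integrable lborel k" and z: "\<And>p. ft k p = 0"
  shows "AE x in lborel. k x = 0"
proof -
  have zc: "ft (\<lambda>x. cnj (k x)) p = 0" for p by (simp add: ft_cnj z)
  have kc: "integrable lborel (\<lambda>x. cnj (k x))" using k by simp
  have re: "of_real (Re (k x)) = (1 / 2) * k x + (1 / 2) * cnj (k x)"
    and im: "of_real (Im (k x)) = (- \<i> / 2) * k x + (\<i> / 2) * cnj (k x)" for x
    by (simp_all add: complex_eq_iff)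
  have lin: "ft (\<lambda>x. c * k x + d * cnj (k x)) p = 0" for c d p
    by (simp only: ft_add[OF integrable_mult_right[OF k] integrable_mult_right[OF kc]] ft_cmult z zc) simp
  have 1: "AE x in lborel. Re (k x) = 0"
    using k by (intro ft_eq_0_imp_AE_real) (auto simp only: re lin integrable_Re)
  have 2: "AE x in lborel. Im (k x) = 0"
    using k by (intro ft_eq_0_imp_AE_real) (auto simp only: im lin integrable_Im)
  from 1 2 show ?thesis by eventually_elim (simp add: complex_eq_iff)
qed

section \<open>Plancherel's theorem\<close>

lemma square_integrable_indicator:
  "square_integrable (\<lambda>x. indicator {-R..R::real} x)"
proof -
  have "(\<lambda>x. (cmod (indicator {-R..R} x))\<^sup>2) = (\<lambda>x. indicator {-R..R} x :: real)"
    by (auto simp: fun_eq_iff indicator_def)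
  moreover have "integrable lborel (\<lambda>x. indicator {-R..R::real} x :: real)"
    by (intro integrable_real_indicator) (simp_all add: emeasure_lborel_Icc_eq)
  ultimately show ?thesis by (simp add: square_integrable_def)
qed

text \<open>A truncation is the product of \<open>g\<close> with a square integrable indicator,
  hence integrable.\<close>

lemma truncation_integrable:
  assumes "square_integrable g"
  shows "integrable lborel (\<lambda>x. indicator {-R..R::real} x *\<^sub>R g x)"
    and "square_integrable (\<lambda>x. indicator {-R..R::real} x *\<^sub>R g x)"
proof -
  have [measurable]: "g \<in> borel_measurable borel"
    using square_integrable_measurable[OF assms] by simp
  have "g x * cnj (indicator {-R..R} x) = indicator {-R..R} x *\<^sub>R g x" for x
    by (simp add: indicator_def)
  then show "integrable lborel (\<lambda>x. indicator {-R..R::real} x *\<^sub>R g x)"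
    using square_integrable_mult[OF assms square_integrable_indicator[of R]] by simp
  show "square_integrable (\<lambda>x. indicator {-R..R::real} x *\<^sub>R g x)"
    by (rule square_integrable_bound[OF assms, where c = 1]) (auto simp: indicator_def)
qed

lemma truncation_tendsto:
  assumes g: "square_integrable g"
  shows "((\<lambda>R::real. L2_of (\<lambda>x. indicator {-R..R} x *\<^sub>R g x)) \<longlongrightarrow> L2_of g) at_top"
proof -
  have [measurable]: "g \<in> borel_measurable borel"
    using square_integrable_measurable[OF g] by simp
  have "((\<lambda>R::real. LINT x|lborel. (cmod (indicator {-R..R} x *\<^sub>R g x - g x))\<^sup>2)
      \<longlongrightarrow> integral\<^sup>L lborel (\<lambda>x::real. 0)) at_top"
  proof (rule integral_dominated_convergence_at_top[where w = "\<lambda>x. (cmod (g x))\<^sup>2"])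
    show "integrable lborel (\<lambda>x. (cmod (g x))\<^sup>2)" using g by (simp add: square_integrable_def)
    show "\<forall>\<^sub>F R in at_top. AE x in lborel. norm ((cmod (indicator {-R..R} x *\<^sub>R g x - g x))\<^sup>2) \<le> (cmod (g x))\<^sup>2"
      by (intro always_eventually allI AE_I2) (simp add: indicator_def)
    show "AE x in lborel. ((\<lambda>R. (cmod (indicator {-R..R} x *\<^sub>R g x - g x))\<^sup>2) \<longlongrightarrow> 0) at_top"
    proof (rule AE_I2, rule tendsto_eventually)
      fix x
      show "\<forall>\<^sub>F R in at_top. (cmod (indicator {-R..R} x *\<^sub>R g x - g x))\<^sup>2 = 0"
        using eventually_ge_at_top[of "\<bar>x\<bar>"] by eventually_elim (auto simp: indicator_def)
    qed
  qed measurable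
  then have "((\<lambda>R::real. sqrt (LINT x|lborel. (cmod (indicator {-R..R} x *\<^sub>R g x - g x))\<^sup>2)) \<longlongrightarrow> sqrt 0) at_top"
    by (intro tendsto_real_sqrt) simp
  moreover have "sqrt (LINT x|lborel. (cmod (indicator {-R..R} x *\<^sub>R g x - g x))\<^sup>2)
      = norm (L2_of (\<lambda>x. indicator {-R..R} x *\<^sub>R g x) - L2_of g)" for R :: real
  proof -
    note T = truncation_integrable(2)[OF g, of R]
    show ?thesis
      unfolding L2_of_diff[OF T g] norm_L2_of[OF square_integrable_diff[OF T g], symmetric]
      by (simp only: real_sqrt_abs abs_norm_cancel)
  qed
  ultimately have "((\<lambda>R::real. norm (L2_of (\<lambda>x. indicator {-R..R} x *\<^sub>R g x) - L2_of g)) \<longlongrightarrow> 0) at_top"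
    by simp
  then show ?thesis by (subst tendsto_dist_iff) (simp add: dist_norm)
qed

lemma integrable_approximation:
  obtains K :: "nat \<Rightarrow> real \<Rightarrow> complex" where
    "\<And>n. integrable lborel (K n)" "\<And>n. square_integrable (K n)" "(\<lambda>n. L2_of (K n)) \<longlonglongrightarrow> u"
proof
  show "(\<lambda>n. L2_of (\<lambda>x. indicator {-real n..real n} x *\<^sub>R rep_L2 u x)) \<longlonglongrightarrow> u"
    using filterlim_compose[OF truncation_tendsto[OF square_integrable_rep] filterlim_real_sequentially, of u]
    by simp
qed (rule truncation_integrable[OF square_integrable_rep])+

lemma ft_diff:
  assumes "integrable lborel f" "integrable lborel g"
  shows "ft (\<lambda>x. f x - g x) p = ft f p - ft g p"
  unfolding ft_def right_diff_distrib
  by (intro Bochner_Integration.integral_diff integrable_iexp_mult assms)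

lemma bessel_ft_diff:
  assumes "integrable lborel k" "square_integrable k" "integrable lborel l" "square_integrable l"
  shows "norm (L2_of (ft k) - L2_of (ft l)) \<le> sqrt (2 * pi) * norm (L2_of k - L2_of l)"
proof -
  have "ft (\<lambda>x. k x - l x) = (\<lambda>p. ft k p - ft l p)"
    using assms by (simp add: fun_eq_iff ft_diff)
  then show ?thesis
    using bessel_ft(2)[of "\<lambda>x. k x - l x"] assms
    by (simp add: L2_of_diff bessel_ft(1) square_integrable_diff)
qed

text \<open>This makes \<open>fourier\<close> usable. The transforms of some approximating sequence
  converge to an \<open>L\<close> by Bessel and completeness; Bessel for differences then controls
  the distance of any other transform to \<open>L\<close>, in particular of the truncations in the
  definition, so the \<open>Lim\<close> is \<open>L\<close>.\<close>

lemma norm_ft_fourier_le: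
  assumes k: "integrable lborel k" "square_integrable k"
  shows "norm (L2_of (ft k) - fourier u) \<le> sqrt (2 * pi) * norm (L2_of k - u)"
proof -
  obtain K :: "nat \<Rightarrow> real \<Rightarrow> complex" where
    K: "\<And>n. integrable lborel (K n)" "\<And>n. square_integrable (K n)" "(\<lambda>n. L2_of (K n)) \<longlonglongrightarrow> u"
    using integrable_approximation[where u = u] by blast
  have "Cauchy (\<lambda>n. L2_of (ft (K n)))"
  proof (rule metric_CauchyI)
    fix e :: real assume "e > 0"
    then have "0 < e / sqrt (2 * pi)" by simp
    then obtain N where N: "\<And>m n. m \<ge> N \<Longrightarrow> n \<ge> N \<Longrightarrow> norm (L2_of (K m) - L2_of (K n)) < e / sqrt (2 * pi)"
      using LIMSEQ_imp_Cauchy[OF K(3)] unfolding Cauchy_iff by meson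
    have "norm (L2_of (ft (K m)) - L2_of (ft (K n))) < e" if "m \<ge> N" "n \<ge> N" for m n
    proof -
      have "sqrt (2 * pi) * norm (L2_of (K m) - L2_of (K n)) < e"
        using N[OF that] by (simp add: field_simps)
      then show ?thesis using bessel_ft_diff[of "K m" "K n"] K(1,2) by (meson le_less_trans)
    qed
    then show "\<exists>M. \<forall>m\<ge>M. \<forall>n\<ge>M. dist (L2_of (ft (K m))) (L2_of (ft (K n))) < e"
      unfolding dist_norm by blast
  qed
  then obtain L where L: "(\<lambda>n. L2_of (ft (K n))) \<longlonglongrightarrow> L"
    using Cauchy_convergent convergent_def by blast
  have le: "norm (L2_of (ft h) - L) \<le> sqrt (2 * pi) * norm (L2_of h - u)"
    if "integrable lborel h" "square_integrable h" for h
  proof (rule LIMSEQ_le)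
    show "(\<lambda>n. norm (L2_of (ft h) - L2_of (ft (K n)))) \<longlonglongrightarrow> norm (L2_of (ft h) - L)"
      by (intro tendsto_intros L)
    show "(\<lambda>n. sqrt (2 * pi) * norm (L2_of h - L2_of (K n))) \<longlonglongrightarrow> sqrt (2 * pi) * norm (L2_of h - u)"
      by (intro tendsto_intros K)
    show "\<exists>N. \<forall>n\<ge>N. norm (L2_of (ft h) - L2_of (ft (K n))) \<le> sqrt (2 * pi) * norm (L2_of h - L2_of (K n))"
      using bessel_ft_diff that K(1,2) by blast
  qed
  let ?T = "\<lambda>R x. indicator {-R..R::real} x *\<^sub>R rep_L2 u x"
  have "((\<lambda>R. L2_of (ft (?T R))) \<longlongrightarrow> L) at_top"
  proof (rule metric_tendsto_imp_tendsto)
    show "\<forall>\<^sub>F R in at_top. dist (L2_of (ft (?T R))) L \<le> dist (sqrt (2 * pi) * norm (L2_of (?T R) - u)) 0"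
      using le truncation_integrable[OF square_integrable_rep[of u]] by (auto simp: dist_norm)
    have "((\<lambda>R. sqrt (2 * pi) * norm (L2_of (?T R) - u)) \<longlongrightarrow> sqrt (2 * pi) * norm (u - u)) at_top"
      using truncation_tendsto[OF square_integrable_rep[of u]] by (intro tendsto_intros) simp
    then show "((\<lambda>R. sqrt (2 * pi) * norm (L2_of (?T R) - u)) \<longlongrightarrow> 0) at_top" by simp
  qed
  moreover have "ft (?T R) = (\<lambda>p. LBINT x:{-R..R}. exp (\<i> * of_real (p * x)) * rep_L2 u x)" for R
    by (simp add: fun_eq_iff ft_def set_lebesgue_integral_def)
  ultimately have "fourier u = L"
    unfolding fourier_def by (intro tendsto_Lim) simp_all
  then show ?thesis using le[OF k] by (simp only:)
qed

lemma fourier_L2_of: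
  assumes "integrable lborel k" "square_integrable k"
  shows "fourier (L2_of k) = L2_of (ft k)"
proof -
  have "norm (L2_of (ft k) - fourier (L2_of k)) \<le> 0"
    using norm_ft_fourier_le[OF assms, of "L2_of k"] by (simp only: diff_self norm_zero mult_zero_right)
  then show ?thesis by (simp only: norm_le_zero_iff right_minus_eq)
qed

lemma ft_tendsto_fourier:
  assumes "\<And>n. integrable lborel (K n)" "\<And>n. square_integrable (K n)" "(\<lambda>n. L2_of (K n)) \<longlonglongrightarrow> u"
  shows "(\<lambda>n. L2_of (ft (K n))) \<longlonglongrightarrow> fourier u"
proof (rule metric_tendsto_imp_tendsto)
  show "\<forall>\<^sub>F n in sequentially. dist (L2_of (ft (K n))) (fourier u) \<le> dist (sqrt (2 * pi) * norm (L2_of (K n) - u)) 0"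
    using norm_ft_fourier_le[OF assms(1,2)] by (intro always_eventually allI) (simp add: dist_norm)
  have "(\<lambda>n. sqrt (2 * pi) * norm (L2_of (K n) - u)) \<longlonglongrightarrow> sqrt (2 * pi) * norm (u - u)"
    by (intro tendsto_intros assms)
  then show "(\<lambda>n. sqrt (2 * pi) * norm (L2_of (K n) - u)) \<longlonglongrightarrow> 0" by simp
qed

section \<open>Extension by continuity: linearity, duality and inversion\<close>

lemma fourier_add: "fourier (u + v) = fourier u + fourier v"
proof -
  obtain K :: "nat \<Rightarrow> real \<Rightarrow> complex" where
    K: "\<And>n. integrable lborel (K n)" "\<And>n. square_integrable (K n)" "(\<lambda>n. L2_of (K n)) \<longlonglongrightarrow> u"
    using integrable_approximation[where u = u] by blast
  obtain H :: "nat \<Rightarrow> real \<Rightarrow> complex" where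
    H: "\<And>n. integrable lborel (H n)" "\<And>n. square_integrable (H n)" "(\<lambda>n. L2_of (H n)) \<longlonglongrightarrow> v"
    using integrable_approximation[where u = v] by blast
  have "ft (\<lambda>x. K n x + H n x) = (\<lambda>p. ft (K n) p + ft (H n) p)" for n
    using K(1) H(1) by (simp add: fun_eq_iff ft_add)
  then have eq: "L2_of (ft (\<lambda>x. K n x + H n x)) = L2_of (ft (K n)) + L2_of (ft (H n))" for n
    by (simp add: L2_of_add bessel_ft(1) K H)
  have "(\<lambda>n. L2_of (ft (\<lambda>x. K n x + H n x))) \<longlonglongrightarrow> fourier (u + v)"
  proof (rule ft_tendsto_fourier)
    show "(\<lambda>n. L2_of (\<lambda>x. K n x + H n x)) \<longlonglongrightarrow> u + v"
      using tendsto_add[OF K(3) H(3)] by (simp add: L2_of_add K(2) H(2))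
  qed (use K H square_integrable_add in auto)
  moreover have "(\<lambda>n. L2_of (ft (\<lambda>x. K n x + H n x))) \<longlonglongrightarrow> fourier u + fourier v"
    unfolding eq by (intro tendsto_add ft_tendsto_fourier K H)
  ultimately show ?thesis by (rule LIMSEQ_unique)
qed

lemma fourier_scaleC: "fourier (c *\<^sub>C u) = c *\<^sub>C fourier u"
proof -
  obtain K :: "nat \<Rightarrow> real \<Rightarrow> complex" where
    K: "\<And>n. integrable lborel (K n)" "\<And>n. square_integrable (K n)" "(\<lambda>n. L2_of (K n)) \<longlonglongrightarrow> u"
    using integrable_approximation[where u = u] by blast
  have "ft (\<lambda>x. c * K n x) = (\<lambda>p. c * ft (K n) p)" for n
    by (simp add: fun_eq_iff ft_cmult)
  then have eq: "L2_of (ft (\<lambda>x. c * K n x)) = c *\<^sub>C L2_of (ft (K n))" for n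
    by (simp add: L2_of_scaleC bessel_ft(1) K)
  have "(\<lambda>n. L2_of (ft (\<lambda>x. c * K n x))) \<longlonglongrightarrow> fourier (c *\<^sub>C u)"
  proof (rule ft_tendsto_fourier)
    show "(\<lambda>n. L2_of (\<lambda>x. c * K n x)) \<longlonglongrightarrow> c *\<^sub>C u"
      using tendsto_scaleC[OF K(3), of c] by (simp add: L2_of_scaleC K(2))
  qed (use K square_integrable_scale in auto)
  moreover have "(\<lambda>n. L2_of (ft (\<lambda>x. c * K n x))) \<longlonglongrightarrow> c *\<^sub>C fourier u"
    unfolding eq by (intro tendsto_scaleC ft_tendsto_fourier K)
  ultimately show ?thesis by (rule LIMSEQ_unique)
qed

text \<open>The multiplication formula passed to the limit; \<open>conj_L2\<close> removes the
  conjugation built into \<open>cinner\<close>.\<close>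

lemma cinner_fourier_conj: "cinner (fourier u) (conj_L2 v) = cinner u (conj_L2 (fourier v))"
proof -
  obtain K :: "nat \<Rightarrow> real \<Rightarrow> complex" where
    K: "\<And>n. integrable lborel (K n)" "\<And>n. square_integrable (K n)" "(\<lambda>n. L2_of (K n)) \<longlonglongrightarrow> u"
    using integrable_approximation[where u = u] by blast
  obtain H :: "nat \<Rightarrow> real \<Rightarrow> complex" where
    H: "\<And>n. integrable lborel (H n)" "\<And>n. square_integrable (H n)" "(\<lambda>n. L2_of (H n)) \<longlonglongrightarrow> v"
    using integrable_approximation[where u = v] by blast
  have "cinner (L2_of (ft (K n))) (conj_L2 (L2_of (H n))) = cinner (L2_of (K n)) (conj_L2 (L2_of (ft (H n))))" for n
    by (simp add: conj_L2_of cinner_L2_of bessel_ft(1) K H square_integrable_cnj ft_multiplication_formula)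
  moreover have "(\<lambda>n. cinner (L2_of (ft (K n))) (conj_L2 (L2_of (H n)))) \<longlonglongrightarrow> cinner (fourier u) (conj_L2 v)"
    by (intro tendsto_cinner tendsto_conj_L2 ft_tendsto_fourier K H)
  moreover have "(\<lambda>n. cinner (L2_of (K n)) (conj_L2 (L2_of (ft (H n))))) \<longlonglongrightarrow> cinner u (conj_L2 (fourier v))"
    by (intro tendsto_cinner tendsto_conj_L2 ft_tendsto_fourier K H)
  ultimately show ?thesis using LIMSEQ_unique by simp
qed

text \<open>Conjugating before and after the transform changes the sign of the exponent, so the
  inverse transform needs no second limit construction.\<close>

definition inverse_fourier :: "L2 \<Rightarrow> L2" where
  "inverse_fourier u = of_real (1 / (2 * pi)) *\<^sub>C conj_L2 (fourier (conj_L2 u))"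

lemma cinner_fourier_left: "cinner (fourier u) v = 2 * pi * cinner u (inverse_fourier v)"
  using cinner_fourier_conj[of u "conj_L2 v"] by (simp add: inverse_fourier_def cinner_scaleC_right)

text \<open>Modulation by \<open>s\<close> becomes a shift of the transform, and transforming the
  shifted Gaussian turns the shift back into a modulation; both transforms are explicit, so
  inversion is a computation.\<close>

lemma inverse_fourier_modulated_gaussian:
  fixes s :: real
  defines "h \<equiv> \<lambda>x. exp (\<i> * complex_of_real (s * x)) * complex_of_real (exp (- x\<^sup>2 / 2))"
  shows "square_integrable h" "inverse_fourier (fourier (L2_of h)) = L2_of h"
proof -
  let ?G = "\<lambda>x. complex_of_real (exp (- x\<^sup>2 / 2))"
  have G: "integrable lborel ?G" using integrable_gaussian[of 1] by simp
  have G2: "square_integrable ?G"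
  proof -
    \<comment> \<open>The square of a Gaussian is again a Gaussian, with scale sqrt 2.\<close>
    have "cmod (complex_of_real (exp (- (sqrt 2 * x)\<^sup>2 / 2))) = (cmod (?G x))\<^sup>2" for x :: real
      by (simp add: power_mult_distrib exp_add[symmetric] power2_eq_square[of "exp _"])
    then show ?thesis
      using integrable_norm[OF integrable_gaussian[of "sqrt 2"]] by (simp add: norm_power square_integrable_def)
  qed
  have h: "integrable lborel h" unfolding h_def by (intro integrable_iexp_mult G)
  show h2: "square_integrable h"
    using borel_measurable_integrable[OF h]
    by (rule square_integrable_bound[OF G2, where c = 1]) (simp add: h_def norm_mult)
  define g where "g p = of_real (sqrt (2 * pi)) * complex_of_real (exp (- (p + s)\<^sup>2 / 2))" for p
  have fth: "ft h p = g p" for p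
  proof -
    have "ft h p = ft ?G (p + s)"
      unfolding ft_def h_def
      by (intro Bochner_Integration.integral_cong)
         (simp_all add: mult.assoc[symmetric] exp_add[symmetric] distrib_left distrib_right)
    then show ?thesis using ft_std_gaussian[of "p + s"] by (simp add: g_def)
  qed
  then have "ft h = g" by (simp add: fun_eq_iff)
  have g: "integrable lborel g"
    unfolding g_def using lborel_integrable_real_affine[OF G, of 1 s]
    by (intro integrable_mult_right) (simp add: add.commute)
  have g2: "square_integrable g" using bessel_ft(1)[OF h h2] by (simp add: \<open>ft h = g\<close>)
  have ftg: "ft g p = of_real (2 * pi) * cnj (h p)" for p
  proof -
    have r: "sqrt (2 * pi) * sqrt (2 * pi) = 2 * pi" by simp
    have "ft ?G p = (LINT x|lborel. exp (\<i> * complex_of_real (p * (s + 1 * x))) * ?G (s + 1 * x))"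
      unfolding ft_def by (subst lborel_integral_real_affine[of 1 _ s]) simp_all
    also have "\<dots> = (LINT x|lborel. exp (\<i> * complex_of_real (p * s)) *
        (exp (\<i> * complex_of_real (p * x)) * ?G (x + s)))"
      by (intro Bochner_Integration.integral_cong)
         (simp_all add: mult.assoc[symmetric] exp_add[symmetric] distrib_left add.commute)
    also have "\<dots> = exp (\<i> * complex_of_real (p * s)) * ft (\<lambda>x. ?G (x + s)) p"
      by (simp add: ft_def)
    finally have "exp (\<i> * complex_of_real (- (p * s))) * ft ?G p = ft (\<lambda>x. ?G (x + s)) p"
      by (simp add: mult.assoc[symmetric] exp_add[symmetric])
    then have "ft g p = of_real (sqrt (2 * pi)) * (exp (\<i> * complex_of_real (- (p * s))) * ft ?G p)"
      unfolding g_def by (simp add: ft_cmult)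
    also have "\<dots> = of_real (sqrt (2 * pi) * sqrt (2 * pi)) * (exp (\<i> * complex_of_real (- (p * s))) * ?G p)"
      unfolding ft_std_gaussian by (simp only: of_real_mult mult_ac)
    also have "\<dots> = of_real (2 * pi) * cnj (h p)"
      unfolding r by (simp add: h_def exp_cnj mult.commute)
    finally show ?thesis .
  qed
  \<comment> \<open>Since \<open>g\<close> is real, the inner conjugation in
    \<open>inverse_fourier\<close> has no effect on it.\<close>
  have gr: "cnj (g p) = g p" for p by (simp add: g_def)
  have "inverse_fourier (fourier (L2_of h)) = of_real (1 / (2 * pi)) *\<^sub>C conj_L2 (L2_of (ft g))"
    by (simp add: inverse_fourier_def fourier_L2_of h h2 g g2 \<open>ft h = g\<close> conj_L2_of gr)
  also have "\<dots> = L2_of h"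
    using bessel_ft(1)[OF g g2]
    by (simp add: conj_L2_of L2_of_scaleC square_integrable_cnj square_integrable_scale h2 ftg)
  finally show "inverse_fourier (fourier (L2_of h)) = L2_of h" .
qed

text \<open>The inner products with all modulations are the values of the transform of
  \<open>d\<close> times a Gaussian. This product is integrable, so it vanishes almost everywhere,
  and the Gaussian has no zeros.\<close>

lemma eq_0_if_orthogonal_gaussians:
  assumes "\<And>s::real. cinner d (L2_of (\<lambda>x. exp (\<i> * complex_of_real (s * x)) * complex_of_real (exp (- x\<^sup>2 / 2)))) = 0"
  shows "d = 0"
proof -
  let ?G = "\<lambda>x. complex_of_real (exp (- x\<^sup>2 / 2))"
  let ?h = "\<lambda>s x. exp (\<i> * complex_of_real (s * x)) * ?G x"
  let ?k = "\<lambda>x. rep_L2 d x * cnj (?G x)"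
  have "ft ?k p = 0" for p
  proof -
    have "ft ?k p = (LINT x|lborel. rep_L2 d x * cnj (?h (- p) x))"
      unfolding ft_def by (intro Bochner_Integration.integral_cong) (simp_all add: exp_cnj mult_ac)
    also have "\<dots> = cinner (L2_of (rep_L2 d)) (L2_of (?h (- p)))"
      by (rule cinner_L2_of[symmetric])
         (rule square_integrable_rep, rule inverse_fourier_modulated_gaussian(1))
    also have "\<dots> = 0" using assms[of "- p"] by simp
    finally show ?thesis .
  qed
  moreover have "integrable lborel ?k"
    using square_integrable_mult[OF square_integrable_rep inverse_fourier_modulated_gaussian(1)[of 0]] by simp
  ultimately have "AE x in lborel. ?k x = 0" by (intro ft_eq_0_imp_AE)
  then have "AE x in lborel. rep_L2 d x = 0" by simp
  then have "L2_of (rep_L2 d) = L2_of (\<lambda>_. 0)"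
    by (subst L2_of_eq_iff) (simp_all add: square_integrable_rep square_integrable_zero)
  then show ?thesis by (simp only: L2_of_rep zero_L2_def)
qed

text \<open>\<open>fourier\<close> and 2 pi times \<open>inverse_fourier\<close> are adjoint to each
  other, so their composition is symmetric and can be moved onto the fixed vector
  \<open>h\<close>.\<close>

lemma cinner_inverse_fourier_fourier:
  assumes h: "inverse_fourier (fourier h) = h"
  shows "cinner (inverse_fourier (fourier u)) h = cinner u h"
proof -
  have "2 * pi * cinner (inverse_fourier (fourier u)) h = cnj (cinner (fourier h) (fourier u))"
    unfolding cinner_fourier_left cinner_commute[of "inverse_fourier (fourier u)" h] by simp
  also have "\<dots> = cinner (fourier u) (fourier h)"
    by (rule cinner_commute[symmetric])
  also have "\<dots> = 2 * pi * cinner u h"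
    by (simp only: cinner_fourier_left h)
  finally show ?thesis by simp
qed

lemma inverse_fourier_fourier [simp]: "inverse_fourier (fourier u) = u"
proof -
  have "inverse_fourier (fourier u) - u = 0"
    by (rule eq_0_if_orthogonal_gaussians)
       (simp only: cinner_diff_left right_minus_eq
         cinner_inverse_fourier_fourier inverse_fourier_modulated_gaussian(2))
  then show ?thesis by simp
qed

text \<open>Conjugation exchanges the two orders of composition, so surjectivity of
  \<open>fourier\<close> follows from inversion.\<close>

lemma fourier_inverse_fourier [simp]: "fourier (inverse_fourier u) = u"
proof -
  have "fourier (inverse_fourier u) = conj_L2 (inverse_fourier (fourier (conj_L2 u)))"
    by (simp only: inverse_fourier_def conj_L2_scaleC fourier_scaleC conj_conj_L2 complex_cnj_complex_of_real)
  then show ?thesis by simp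
qed

lemma plancherel: "cinner (fourier u) (fourier v) = 2 * pi * cinner u v"
  by (simp add: cinner_fourier_left)

lemma norm_inverse_fourier: "norm (inverse_fourier u) = norm u / sqrt (2 * pi)"
proof -
  have "(norm u)\<^sup>2 = 2 * pi * (norm (inverse_fourier u))\<^sup>2"
    using plancherel[of "inverse_fourier u" "inverse_fourier u"]
    unfolding fourier_inverse_fourier cinner_self_eq_norm of_real_mult[symmetric] of_real_eq_iff .
  then have "norm u = sqrt (2 * pi * (norm (inverse_fourier u))\<^sup>2)"
    by (intro real_sqrt_unique[symmetric]) simp_all
  also have "\<dots> = sqrt (2 * pi) * norm (inverse_fourier u)"
    by (simp add: real_sqrt_mult)
  finally show ?thesis by (simp add: eq_divide_eq mult.commute)
qed

section \<open>The perturbed generator\<close>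

lemma inverse_fourier_L2_of:
  assumes H: "integrable lborel H" "square_integrable H"
  shows "square_integrable (\<lambda>x. ft H (- x) / (2 * of_real pi))"
    and "inverse_fourier (L2_of H) = L2_of (\<lambda>x. ft H (- x) / (2 * of_real pi))"
proof -
  let ?Hc = "\<lambda>p. cnj (H p)"
  have c: "integrable lborel ?Hc" "square_integrable ?Hc"
    using H by (auto intro: square_integrable_cnj)
  have eq: "(\<lambda>x. ft H (- x)) = (\<lambda>x. cnj (ft ?Hc x))"
    by (simp add: ft_cnj)
  have sq: "square_integrable (\<lambda>x. ft H (- x))"
    unfolding eq by (intro square_integrable_cnj bessel_ft(1) c)
  show "square_integrable (\<lambda>x. ft H (- x) / (2 * of_real pi))"
    using square_integrable_scale[OF sq, of "1 / (2 * of_real pi)"] by simp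
  have "inverse_fourier (L2_of H) = of_real (1 / (2 * pi)) *\<^sub>C L2_of (\<lambda>x. ft H (- x))"
    unfolding inverse_fourier_def conj_L2_of[OF H(2)] fourier_L2_of[OF c] conj_L2_of[OF bessel_ft(1)[OF c]] eq ..
  also have "\<dots> = L2_of (\<lambda>x. ft H (- x) / (2 * of_real pi))"
    by (simp add: L2_of_scaleC[OF sq])
  finally show "inverse_fourier (L2_of H) = L2_of (\<lambda>x. ft H (- x) / (2 * of_real pi))" .
qed

text \<open>A nonempty open set is not negligible. This is the uniqueness behind
  \<open>cont_rep\<close>.\<close>

lemma continuous_AE_eq_imp_eq:
  fixes f g :: "real \<Rightarrow> complex"
  assumes "continuous_on UNIV f" "continuous_on UNIV g" "AE x in lborel. f x = g x"
  shows "f = g"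
proof -
  have op: "open {x. f x \<noteq> g x}"
    by (rule open_Collect_neq[OF assms(1,2)])
  then have "{x. f x \<noteq> g x} \<in> null_sets lborel"
    using assms(3) by (subst AE_iff_null_sets) auto
  then have "negligible {x. f x \<noteq> g x}"
    by (simp add: negligible_iff_null_sets null_sets_completionI)
  with op have "{x. f x \<noteq> g x} = {}" using open_not_negligible by blast
  then show ?thesis by auto
qed

lemma cont_rep_inverse_fourier:
  assumes H: "integrable lborel H" "square_integrable H"
  shows "cont_rep (inverse_fourier (L2_of H)) x = ft H (- x) / (2 * of_real pi)"
proof -
  let ?f = "\<lambda>x. ft H (- x) / (2 * of_real pi)"
  have cont: "continuous_on UNIV ?f"
    by (intro continuous_intros continuous_on_compose2[OF continuous_on_ft[OF H(1)]]) auto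
  note sq = inverse_fourier_L2_of[OF H]
  have "cont_rep (inverse_fourier (L2_of H)) = ?f"
    unfolding cont_rep_def
  proof (rule the_equality)
    show "continuous_on UNIV ?f \<and> square_integrable ?f \<and> L2_of ?f = inverse_fourier (L2_of H)"
      using cont sq by simp
  next
    fix g assume g: "continuous_on UNIV g \<and> square_integrable g \<and> L2_of g = inverse_fourier (L2_of H)"
    then have "AE x in lborel. g x = ?f x" using sq L2_of_eq_iff[of g ?f] by simp
    then show "g = ?f" using g cont continuous_AE_eq_imp_eq by blast
  qed
  then show ?thesis by simp
qed

lemma fourier_inject: "fourier u = fourier v \<Longrightarrow> u = v"
  by (metis inverse_fourier_fourier)

text \<open>Injectivity of \<open>fourier\<close> makes the description in \<open>generator\<close>
  unique, so exhibiting one candidate suffices.\<close>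

lemma generator_eqI:
  assumes "AE p in lborel. rep_L2 (fourier w) p = - of_real (\<Psi> p) * rep_L2 (fourier u) p"
  shows "generator \<Psi> u = w"
  unfolding generator_def
proof (rule the_equality[where a = w])
  show "AE p in lborel. rep_L2 (fourier w) p = - of_real (\<Psi> p) * rep_L2 (fourier u) p" by fact
next
  fix w' assume "AE p in lborel. rep_L2 (fourier w') p = - of_real (\<Psi> p) * rep_L2 (fourier u) p"
  with assms have "AE p in lborel. rep_L2 (fourier w') p = rep_L2 (fourier w) p"
    by eventually_elim simp
  then have "fourier w' = fourier w" by (simp only: L2_eq_iff)
  then show "w' = w" by (rule fourier_inject)
qed

lemma AE_rep_add: "AE x in lborel. rep_L2 (u + v) x = rep_L2 u x + rep_L2 v x"
  using AE_rep_L2_of[OF square_integrable_add[OF square_integrable_rep[of u] square_integrable_rep[of v]]]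
  by (simp add: L2_of_add[symmetric] square_integrable_rep)

lemma AE_rep_scaleC: "AE x in lborel. rep_L2 (c *\<^sub>C u) x = c * rep_L2 u x"
  using AE_rep_L2_of[OF square_integrable_scale[OF square_integrable_rep[of u], of c]]
  by (simp add: L2_of_scaleC[symmetric] square_integrable_rep)

lemma cinner_rep: "cinner u v = (LINT x|lborel. rep_L2 u x * cnj (rep_L2 v x))"
  using cinner_L2_of[OF square_integrable_rep[of u] square_integrable_rep[of v]] by simp

text \<open>Collects the properties of the exponent on which the operator argument rests.
  \<open>psi_0\<close> is the form in which mu * psi_nu(0) = 1 enters.\<close>

locale point_perturbation =
  fixes \<Psi> :: "real \<Rightarrow> real" and \<nu> a :: real
  assumes measurable_symbol [measurable]: "\<Psi> \<in> borel_measurable borel"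
    and symbol_nonneg: "0 \<le> \<Psi> p"
    and integrable_symbol: "integrable lborel (\<lambda>p. 1 / (1 + \<Psi> p))"
    and nu_pos: "0 < \<nu>"
    and psi_0: "psi \<Psi> (of_real \<nu>) 0 \<noteq> 0"
begin

section \<open>Green function and resolvent as Fourier multipliers\<close>

definition q :: "real \<Rightarrow> real" where "q p = \<Psi> p + \<nu>"

text \<open>The transform of \<open>green\<close>, established in \<open>fourier_green\<close>; the
  character encodes the shift by \<open>a\<close>.\<close>

definition green_ft :: "real \<Rightarrow> complex" where
  "green_ft p = exp (\<i> * of_real (p * a)) / of_real (q p)"

abbreviation green :: L2 where "green \<equiv> psi_shift \<Psi> \<nu> a"

definition resolvent :: "L2 \<Rightarrow> L2" where
  "resolvent h = inverse_fourier (L2_of (\<lambda>p. - (rep_L2 (fourier h) p / of_real (q p))))"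

lemma q_ge: "\<nu> \<le> q p" and q_pos: "0 < q p"
  using symbol_nonneg[of p] nu_pos by (auto simp: q_def)

lemma q_neq_0 [simp]: "q p \<noteq> 0"
  using q_pos[of p] by simp

lemma measurable_q [measurable]: "q \<in> borel_measurable borel"
  unfolding q_def by measurable

lemma measurable_green_ft [measurable]: "green_ft \<in> borel_measurable borel"
  unfolding green_ft_def by measurable

lemma cmod_green_ft: "cmod (green_ft p) = 1 / q p"
  unfolding green_ft_def norm_divide norm_iexp using q_pos[of p] by simp

lemma cmod_green_ft_le: "cmod (green_ft p) \<le> (1 + 1 / \<nu>) * (1 / (1 + \<Psi> p))"
proof -
  \<comment> \<open>The right side expands to 1 + \<Psi> p plus the nonnegative terms \<nu> and
    \<Psi> p / \<nu>.\<close>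
  have "1 + \<Psi> p \<le> (1 + 1 / \<nu>) * q p"
    using symbol_nonneg[of p] nu_pos by (simp add: q_def field_simps)
  then show ?thesis
    using symbol_nonneg[of p] q_pos[of p] by (simp add: cmod_green_ft field_simps)
qed

lemma integrable_green_ft: "integrable lborel green_ft"
proof (rule Bochner_Integration.integrable_bound)
  show "integrable lborel (\<lambda>p. (1 + 1 / \<nu>) * (1 / (1 + \<Psi> p)))"
    using integrable_symbol by (rule integrable_mult_right)
  show "AE p in lborel. norm (green_ft p) \<le> norm ((1 + 1 / \<nu>) * (1 / (1 + \<Psi> p)))"
    using cmod_green_ft_le by (intro AE_I2) (metis abs_ge_self order_trans real_norm_def)
qed measurable

lemma square_integrable_green_ft: "square_integrable green_ft"
proof -
  have "integrable lborel (\<lambda>p. (cmod (green_ft p))\<^sup>2)"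
  proof (rule Bochner_Integration.integrable_bound)
    show "integrable lborel (\<lambda>p. (1 / \<nu>) * cmod (green_ft p))"
      using integrable_green_ft by simp
    have "(cmod (green_ft p))\<^sup>2 \<le> (1 / \<nu>) * cmod (green_ft p)" for p
    proof -
      have "1 / q p \<le> 1 / \<nu>" using q_ge nu_pos by (simp add: frac_le)
      then show ?thesis
        unfolding power2_eq_square by (intro mult_right_mono) (simp_all add: cmod_green_ft less_imp_le[OF q_pos])
    qed
    then show "AE p in lborel. norm ((cmod (green_ft p))\<^sup>2) \<le> norm ((1 / \<nu>) * cmod (green_ft p))"
      using nu_pos by (intro AE_I2) simp
  qed measurable
  then show ?thesis by (simp add: square_integrable_def)
qed

lemma psi_eq_ft: "psi \<Psi> (of_real \<nu>) (x - a) = ft green_ft (- x) / (2 * of_real pi)"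
proof -
  have "exp (- \<i> * of_real (p * (x - a))) / (of_real (\<Psi> p) + of_real \<nu>)
      = exp (\<i> * of_real (- x * p)) * green_ft p" for p
  proof -
    have "exp (\<i> * complex_of_real (- x * p)) * exp (\<i> * of_real (p * a)) = exp (- \<i> * of_real (p * (x - a)))"
      unfolding exp_add[symmetric] by (simp add: algebra_simps)
    then show ?thesis by (simp only: green_ft_def q_def times_divide_eq_right of_real_add)
  qed
  then show ?thesis
    unfolding psi_def ft_def by simp
qed

lemma green_eq: "green = inverse_fourier (L2_of green_ft)"
  unfolding psi_shift_def psi_eq_ft
  by (rule inverse_fourier_L2_of(2)[OF integrable_green_ft square_integrable_green_ft, symmetric])

lemma fourier_green: "fourier green = L2_of green_ft"
  by (simp add: green_eq)

lemma AE_fourier_green: "AE p in lborel. rep_L2 (fourier green) p = green_ft p"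
  unfolding fourier_green by (rule AE_rep_L2_of[OF square_integrable_green_ft])

lemma square_integrable_div_q:
  assumes "square_integrable f"
  shows "square_integrable (\<lambda>p. - (f p / of_real (q p)))"
proof (rule square_integrable_bound[OF assms, where c = "1 / \<nu>"])
  have [measurable]: "f \<in> borel_measurable borel"
    using square_integrable_measurable[OF assms] by simp
  show "(\<lambda>p. - (f p / of_real (q p))) \<in> borel_measurable lborel" by measurable
  have "cmod (f p) / q p \<le> cmod (f p) / \<nu>" for p
    using q_ge nu_pos by (intro divide_left_mono) (auto intro: mult_pos_pos q_pos)
  then show "AE p in lborel. cmod (- (f p / of_real (q p))) \<le> 1 / \<nu> * cmod (f p)"
    using q_pos by (intro AE_I2) (simp add: norm_divide abs_of_pos)
qed

lemma AE_fourier_resolvent: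
  "AE p in lborel. rep_L2 (fourier (resolvent h)) p = - (rep_L2 (fourier h) p / of_real (q p))"
  unfolding resolvent_def fourier_inverse_fourier
  by (rule AE_rep_L2_of[OF square_integrable_div_q[OF square_integrable_rep]])

lemma resolvent_eqI:
  assumes "AE p in lborel. - (of_real (q p) * rep_L2 (fourier u) p) = rep_L2 (fourier h) p"
  shows "resolvent h = u"
proof (rule fourier_inject, unfold L2_eq_iff)
  show "AE p in lborel. rep_L2 (fourier (resolvent h)) p = rep_L2 (fourier u) p"
    using assms AE_fourier_resolvent[of h]
  proof eventually_elim
    case (elim p)
    show ?case unfolding elim(2) elim(1)[symmetric] by simp
  qed
qed

lemma resolvent_add: "resolvent (g + h) = resolvent g + resolvent h"
proof (rule resolvent_eqI)
  have *: "fourier (resolvent g + resolvent h) = fourier (resolvent g) + fourier (resolvent h)"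
    "fourier (g + h) = fourier g + fourier h" by (simp_all add: fourier_add)
  show "AE p in lborel. - (of_real (q p) * rep_L2 (fourier (resolvent g + resolvent h)) p)
      = rep_L2 (fourier (g + h)) p"
    unfolding *
    using AE_rep_add[of "fourier g" "fourier h"] AE_rep_add[of "fourier (resolvent g)" "fourier (resolvent h)"]
      AE_fourier_resolvent[of g] AE_fourier_resolvent[of h]
    by eventually_elim (simp add: distrib_left right_diff_distrib)
qed

lemma resolvent_scaleC: "resolvent (c *\<^sub>C h) = c *\<^sub>C resolvent h"
proof (rule resolvent_eqI)
  show "AE p in lborel. - (of_real (q p) * rep_L2 (fourier (c *\<^sub>C resolvent h)) p)
      = rep_L2 (fourier (c *\<^sub>C h)) p"
    unfolding fourier_scaleC
    using AE_rep_scaleC[of c "fourier h"] AE_rep_scaleC[of c "fourier (resolvent h)"]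
      AE_fourier_resolvent[of h]
    by eventually_elim simp
qed

lemma resolvent_0 [simp]: "resolvent 0 = 0"
  using resolvent_scaleC[of 0 0] by simp

lemma resolvent_diff: "resolvent (g - h) = resolvent g - resolvent h"
  using resolvent_add[of "g - h" h] by (simp add: eq_diff_eq)

text \<open>By Plancherel, since the multiplier - 1 / q is real.\<close>

lemma cinner_resolvent: "cinner (resolvent g) h = cinner g (resolvent h)"
proof -
  have "cinner (fourier (resolvent g)) (fourier h) = cinner (fourier g) (fourier (resolvent h))"
    unfolding cinner_rep
  proof (rule integral_cong_AE)
    show "AE p in lborel. rep_L2 (fourier (resolvent g)) p * cnj (rep_L2 (fourier h) p)
        = rep_L2 (fourier g) p * cnj (rep_L2 (fourier (resolvent h)) p)"
      using AE_fourier_resolvent[of g] AE_fourier_resolvent[of h] by eventually_elim simp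
  qed measurable
  then show ?thesis by (simp add: plancherel)
qed

lemma resolvent_in_V21: "resolvent h \<in> V21 \<Psi>"
  unfolding V21_def mem_Collect_eq
proof (rule Bochner_Integration.integrable_bound)
  show "integrable lborel (\<lambda>p. (1 + 1 / \<nu>\<^sup>2) * (cmod (rep_L2 (fourier h) p))\<^sup>2)"
    using square_integrable_rep[of "fourier h"] by (simp add: square_integrable_def)
  show "AE p in lborel. norm ((1 + (\<Psi> p)\<^sup>2) * (cmod (rep_L2 (fourier (resolvent h)) p))\<^sup>2)
      \<le> norm ((1 + 1 / \<nu>\<^sup>2) * (cmod (rep_L2 (fourier h) p))\<^sup>2)"
    using AE_fourier_resolvent[of h]
  proof eventually_elim
    case (elim p)
    \<comment> \<open>Since q dominates both \<nu> and \<Psi>, the quotient (1 + \<Psi>^2) / q^2 is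
      at most 1 / \<nu>^2 + 1, which is the constant of the majorant.\<close>
    have "\<nu>\<^sup>2 \<le> (q p)\<^sup>2" "(\<Psi> p)\<^sup>2 \<le> (q p)\<^sup>2"
      using q_ge[of p] symbol_nonneg[of p] nu_pos by (auto simp: q_def intro!: power_mono)
    then have "1 + (\<Psi> p)\<^sup>2 \<le> (1 + 1 / \<nu>\<^sup>2) * (q p)\<^sup>2"
      using nu_pos by (simp add: distrib_right) (simp add: field_simps add_mono)
    then have "(1 + (\<Psi> p)\<^sup>2) / (q p)\<^sup>2 \<le> 1 + 1 / \<nu>\<^sup>2"
      using q_pos[of p] by (simp add: pos_divide_le_eq)
    then have "(1 + (\<Psi> p)\<^sup>2) / (q p)\<^sup>2 * (cmod (rep_L2 (fourier h) p))\<^sup>2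
        \<le> (1 + 1 / \<nu>\<^sup>2) * (cmod (rep_L2 (fourier h) p))\<^sup>2"
      by (rule mult_right_mono) simp
    then show ?case
      unfolding elim by (simp add: norm_divide power_divide abs_mult)
  qed
qed measurable

text \<open>The preimage has transform - q times that of \<phi>; it is square integrable because q^2
  is at most 2 \<Psi>^2 + 2 \<nu>^2. With \<open>resolvent_in_V21\<close> the range of the resolvent
  is exactly \<open>V21 \<Psi>\<close>.\<close>

lemma resolvent_surj:
  assumes "\<phi> \<in> V21 \<Psi>"
  obtains h where "\<phi> = resolvent h"
proof -
  let ?H = "rep_L2 (fourier \<phi>)"
  let ?f = "\<lambda>p. - (of_real (q p) * ?H p)"
  have "integrable lborel (\<lambda>p. (cmod (?f p))\<^sup>2)"
  proof (rule Bochner_Integration.integrable_bound)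
    show "integrable lborel (\<lambda>p. (2 + 2 * \<nu>\<^sup>2) * ((1 + (\<Psi> p)\<^sup>2) * (cmod (?H p))\<^sup>2))"
      using assms by (intro integrable_mult_right) (simp add: V21_def)
    have "(cmod (?f p))\<^sup>2 \<le> (2 + 2 * \<nu>\<^sup>2) * ((1 + (\<Psi> p)\<^sup>2) * (cmod (?H p))\<^sup>2)" for p
    proof -
      have "(q p)\<^sup>2 \<le> 2 * (\<Psi> p)\<^sup>2 + 2 * \<nu>\<^sup>2"
        using sum_squares_bound[of "\<Psi> p" \<nu>] by (simp add: q_def power2_sum)
      also have "\<dots> \<le> (2 + 2 * \<nu>\<^sup>2) * (1 + (\<Psi> p)\<^sup>2)"
        by (simp add: algebra_simps)
      finally have "(q p)\<^sup>2 * (cmod (?H p))\<^sup>2 \<le> (2 + 2 * \<nu>\<^sup>2) * (1 + (\<Psi> p)\<^sup>2) * (cmod (?H p))\<^sup>2"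
        by (rule mult_right_mono) simp
      then show ?thesis by (simp add: norm_mult power_mult_distrib mult.assoc)
    qed
    then show "AE p in lborel. norm ((cmod (?f p))\<^sup>2)
        \<le> norm ((2 + 2 * \<nu>\<^sup>2) * ((1 + (\<Psi> p)\<^sup>2) * (cmod (?H p))\<^sup>2))"
      by (intro AE_I2) simp
  qed measurable
  then have f: "square_integrable ?f" by (simp add: square_integrable_def)
  have "resolvent (inverse_fourier (L2_of ?f)) = \<phi>"
    using AE_rep_L2_of[OF f] by (intro resolvent_eqI) (simp add: eq_commute)
  then show thesis by (rule that[OF sym])
qed

text \<open>As multipliers: (- \<Psi>) (- 1 / q) = 1 - \<nu> / q, because \<Psi> = q -
  \<nu>.\<close>

lemma generator_resolvent: "generator \<Psi> (resolvent h) = h + of_real \<nu> *\<^sub>C resolvent h"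
proof (rule generator_eqI)
  show "AE p in lborel. rep_L2 (fourier (h + of_real \<nu> *\<^sub>C resolvent h)) p
      = - of_real (\<Psi> p) * rep_L2 (fourier (resolvent h)) p"
    unfolding fourier_add fourier_scaleC
    using AE_rep_add[of "fourier h" "of_real \<nu> *\<^sub>C fourier (resolvent h)"]
      AE_rep_scaleC[of "of_real \<nu>" "fourier (resolvent h)"] AE_fourier_resolvent[of h]
  proof eventually_elim
    case (elim p)
    have \<Psi>: "complex_of_real (\<Psi> p) = of_real (q p) - of_real \<nu>" by (simp add: q_def)
    show ?case unfolding elim \<Psi> by (simp add: left_diff_distrib diff_divide_distrib)
  qed
qed

lemma cont_rep_resolvent: "cont_rep (resolvent h) a = - cinner h green"
proof -
  let ?H = "\<lambda>p. - (rep_L2 (fourier h) p / of_real (q p))"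
  have eq: "rep_L2 (fourier h) p * cnj (green_ft p) = - (exp (\<i> * of_real (- a * p)) * ?H p)" for p
    by (simp add: green_ft_def exp_cnj mult.commute)
  \<comment> \<open>The transform of the resolvent is integrable as a product of two square
    integrable functions, since 1 / q is the modulus of \<open>green_ft\<close>. This is what gives
    every element of \<open>V21 \<Psi>\<close> a continuous representative.\<close>
  have "integrable lborel (\<lambda>p. rep_L2 (fourier h) p * cnj (of_real (cmod (green_ft p))))"
    using square_integrable_green_ft
    by (intro square_integrable_mult square_integrable_rep)
       (rule square_integrable_bound[where c = 1 and g = green_ft], auto)
  then have "integrable lborel (\<lambda>p. rep_L2 (fourier h) p * of_real (1 / q p))"
    by (simp only: cmod_green_ft complex_cnj_complex_of_real)
  then have int: "integrable lborel ?H" by (simp add: divide_inverse)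
  have "cont_rep (resolvent h) a = ft ?H (- a) / (2 * of_real pi)"
    unfolding resolvent_def
    by (rule cont_rep_inverse_fourier[OF int square_integrable_div_q[OF square_integrable_rep]])
  also have "ft ?H (- a) = - (LINT p|lborel. rep_L2 (fourier h) p * cnj (green_ft p))"
    unfolding eq by (simp add: ft_def)
  also have "(LINT p|lborel. rep_L2 (fourier h) p * cnj (green_ft p)) = cinner (fourier h) (fourier green)"
    unfolding fourier_green
    using cinner_L2_of[OF square_integrable_rep[of "fourier h"] square_integrable_green_ft] by simp
  also have "\<dots> = 2 * pi * cinner h green" by (rule plancherel)
  finally show ?thesis by simp
qed

text \<open>With \<phi> = \<open>resolvent h\<close>, the condition \<phi>(a) = 0 reads h orthogonal
  to \<open>green\<close>, and the \<nu> from \<open>generator_resolvent\<close> is the eigenvalue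
  attached to \<open>green\<close>, so the two \<nu> terms combine into \<nu> u. All later arguments
  use this form.\<close>

lemma perturbed_generator_eq:
  "perturbed_generator \<Psi> \<nu> a =
    {(u, h + of_real \<nu> *\<^sub>C u) | u h. cinner h green = 0 \<and> (\<exists>C. u = resolvent h + C *\<^sub>C green)}"
  (is "_ = ?T")
proof (rule set_eqI)
  fix x
  have graph: "(resolvent h + C *\<^sub>C green, generator \<Psi> (resolvent h) + (C * of_real \<nu>) *\<^sub>C green)
      = (resolvent h + C *\<^sub>C green, h + of_real \<nu> *\<^sub>C (resolvent h + C *\<^sub>C green))" for h C
    by (simp add: generator_resolvent scaleC_add scaleC_scaleC mult.commute)
  have "x \<in> perturbed_generator \<Psi> \<nu> a \<longleftrightarrow>
      (\<exists>h C. x = (resolvent h + C *\<^sub>C green, generator \<Psi> (resolvent h) + (C * of_real \<nu>) *\<^sub>C green)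
        \<and> cinner h green = 0)"
    unfolding perturbed_generator_def
    using resolvent_in_V21 by (auto simp: cont_rep_resolvent elim!: resolvent_surj)
  then show "x \<in> perturbed_generator \<Psi> \<nu> a \<longleftrightarrow> x \<in> ?T"
    unfolding graph by blast
qed

text \<open>If the resolvent of \<open>h\<close> were \<open>C\<close> times the Green function, the Fourier transform of \<open>h\<close>
  would be a multiple of a character, and pairing it with the Green function gives
  \<open>C\<close> times \<^term>\<open>psi \<Psi> (of_real \<nu>) 0\<close>.\<close>

lemma resolvent_eq_green_imp_0:
  assumes h: "cinner h green = 0" and eq: "resolvent h = C *\<^sub>C green"
  shows "h = 0"
proof -
  have "AE p in lborel. rep_L2 (fourier (C *\<^sub>C green)) p = C * rep_L2 (fourier green) p"
    unfolding fourier_scaleC by (rule AE_rep_scaleC)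
  with AE_fourier_resolvent[of h] AE_fourier_green
  have AE: "AE p in lborel. rep_L2 (fourier h) p = - (of_real (q p) * (C * green_ft p))"
    unfolding eq
  proof eventually_elim
    case (elim p)
    then have "- (rep_L2 (fourier h) p / of_real (q p)) = C * green_ft p" by simp
    then have "- rep_L2 (fourier h) p = of_real (q p) * (C * green_ft p)"
      by (simp add: field_simps flip: minus_divide_left)
    then show ?case by (metis minus_minus)
  qed
  have "0 = cinner (fourier h) (fourier green)" by (simp add: plancherel h)
  also have "\<dots> = (LINT p|lborel. - C * (1 / (of_real (\<Psi> p) + of_real \<nu>)))"
    unfolding cinner_rep
  proof (rule integral_cong_AE)
    show "AE p in lborel. rep_L2 (fourier h) p * cnj (rep_L2 (fourier green) p)
        = - C * (1 / (of_real (\<Psi> p) + of_real \<nu>))"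
      using AE AE_fourier_green
    proof eventually_elim
      case (elim p)
      have "green_ft p * cnj (green_ft p) = of_real ((1 / q p)\<^sup>2)"
        using complex_norm_square[of "green_ft p"] by (simp only: cmod_green_ft)
      then have "rep_L2 (fourier h) p * cnj (rep_L2 (fourier green) p)
          = - (of_real (q p) * C * of_real ((1 / q p)\<^sup>2))"
        unfolding elim by (simp add: mult.assoc)
      also have "\<dots> = - C * (1 / of_real (q p))"
        by (simp add: power2_eq_square)
      finally show ?case by (simp add: q_def)
    qed
  qed measurable
  also have "\<dots> = - C * (2 * of_real pi * psi \<Psi> (of_real \<nu>) 0)"
    unfolding psi_def integral_mult_right_zero by simp
  finally have "C = 0" using psi_0 by simp
  with AE have "AE p in lborel. rep_L2 (fourier h) p = rep_L2 (fourier (0 *\<^sub>C h)) p"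
    unfolding fourier_scaleC using AE_rep_scaleC[of 0 "fourier h"]
    by (auto elim: eventually_elim2)
  then have "fourier h = fourier (0 *\<^sub>C h)" by (simp only: L2_eq_iff)
  then show ?thesis using fourier_inject by fastforce
qed

end

section \<open>Density of the domain\<close>

context point_perturbation
begin

text \<open>The bound on p gives finite measure, so truncated characters are square integrable; the
  bound on \<Psi> keeps functions supported here square integrable after multiplication by
  q.\<close>

definition low :: "nat \<Rightarrow> real set" where
  "low n = {p. \<bar>p\<bar> \<le> real n \<and> \<Psi> p \<le> real n}"

lemma measurable_low [measurable]: "low n \<in> sets borel"
  unfolding low_def by measurable

lemma emeasure_low_finite: "emeasure lborel (low n) < \<infinity>"
proof -
  have "emeasure lborel (low n) \<le> emeasure lborel {- real n..real n}"
    by (rule emeasure_mono) (auto simp: low_def)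
  also have "\<dots> < \<infinity>" by (simp add: emeasure_lborel_Icc_eq)
  finally show ?thesis .
qed

lemma eventually_low: "\<forall>\<^sub>F n in sequentially. p \<in> low n"
proof -
  obtain k where "max \<bar>p\<bar> (\<Psi> p) \<le> real k" using real_arch_simple by blast
  then show ?thesis
    by (intro eventually_sequentiallyI[of k]) (auto simp: low_def)
qed

text \<open>The sets increase to the whole line, which has infinite measure.\<close>

lemma measure_low_unbounded: "\<exists>n. B < measure lborel (low n)"
proof -
  have "(SUP n. emeasure lborel (low n)) = emeasure lborel (\<Union>n. low n)"
    by (rule SUP_emeasure_incseq) (auto simp: incseq_def low_def)
  also have "(\<Union>n. low n) = UNIV"
    using eventually_low by (fastforce simp: eventually_sequentially)
  finally have "ennreal (max 0 B) < (SUP n. emeasure lborel (low n))"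
    by (simp only:) simp
  then obtain n where "ennreal (max 0 B) < emeasure lborel (low n)"
    unfolding less_SUP_iff by blast
  moreover have "emeasure lborel (low n) = ennreal (measure lborel (low n))"
    using emeasure_low_finite[of n] by (intro emeasure_eq_ennreal_measure) auto
  ultimately have "max 0 B < measure lborel (low n)"
    by (simp only: ennreal_less_iff[of "max 0 B"] max.cobounded1)
  then show ?thesis by auto
qed

lemma square_integrable_low:
  assumes f: "f \<in> borel_measurable borel" and bnd: "\<And>p. cmod (f p) \<le> 1"
  shows "square_integrable (\<lambda>p. indicator (low n) p *\<^sub>R f p)"
proof -
  have "integrable lborel (\<lambda>p. (cmod (indicator (low n) p *\<^sub>R f p))\<^sup>2)"
  proof (rule Bochner_Integration.integrable_bound)
    show "integrable lborel (indicator (low n) :: real \<Rightarrow> real)"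
      using emeasure_low_finite by (intro integrable_real_indicator) auto
    show "AE p in lborel. norm ((cmod (indicator (low n) p *\<^sub>R f p))\<^sup>2) \<le> norm (indicator (low n) p :: real)"
      using bnd by (intro AE_I2) (simp add: indicator_def abs_square_le_1)
  qed (use f in measurable)
  then show ?thesis using f by (simp add: square_integrable_def)
qed

lemma square_integrable_low_mult:
  assumes "square_integrable f"
  shows "square_integrable (\<lambda>p. indicator (low n) p *\<^sub>R f p)"
proof (rule square_integrable_bound[OF assms, where c = 1])
  show "(\<lambda>p. indicator (low n) p *\<^sub>R f p) \<in> borel_measurable lborel"
    using square_integrable_measurable[OF assms] by simp
qed (simp add: indicator_def)

lemma low_tendsto:
  assumes f: "square_integrable f"
  shows "(\<lambda>n. L2_of (\<lambda>p. indicator (low n) p *\<^sub>R f p)) \<longlonglongrightarrow> L2_of f"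
proof -
  note fn = square_integrable_low_mult[OF f]
  have [measurable]: "f \<in> borel_measurable borel"
    using square_integrable_measurable[OF f] by simp
  have "(\<lambda>n. LINT p|lborel. (cmod (indicator (low n) p *\<^sub>R f p - f p))\<^sup>2)
      \<longlonglongrightarrow> integral\<^sup>L lborel (\<lambda>p::real. 0)"
  proof (rule integral_dominated_convergence[where w = "\<lambda>p. (cmod (f p))\<^sup>2"])
    show "integrable lborel (\<lambda>p. (cmod (f p))\<^sup>2)" using f by (simp add: square_integrable_def)
    show "AE p in lborel. norm ((cmod (indicator (low n) p *\<^sub>R f p - f p))\<^sup>2) \<le> (cmod (f p))\<^sup>2" for n
      by (intro AE_I2) (simp add: indicator_def)
    show "AE p in lborel. (\<lambda>n. (cmod (indicator (low n) p *\<^sub>R f p - f p))\<^sup>2) \<longlonglongrightarrow> 0"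
    proof (rule AE_I2, rule tendsto_eventually)
      fix p
      show "\<forall>\<^sub>F n in sequentially. (cmod (indicator (low n) p *\<^sub>R f p - f p))\<^sup>2 = 0"
        using eventually_low[of p] by eventually_elim simp
    qed
  qed measurable
  then have "(\<lambda>n. (norm (L2_of (\<lambda>p. indicator (low n) p *\<^sub>R f p) - L2_of f))\<^sup>2) \<longlonglongrightarrow> 0"
    unfolding L2_of_diff[OF fn f] norm_L2_of[OF square_integrable_diff[OF fn f]] by simp
  then have "(\<lambda>n. sqrt ((norm (L2_of (\<lambda>p. indicator (low n) p *\<^sub>R f p) - L2_of f))\<^sup>2)) \<longlonglongrightarrow> sqrt 0"
    by (rule tendsto_real_sqrt)
  then show ?thesis
    by (subst tendsto_dist_iff) (simp add: dist_norm)
qed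

lemma square_integrable_q_low_mult:
  assumes "square_integrable f"
  shows "square_integrable (\<lambda>p. of_real (q p) * (indicator (low n) p *\<^sub>R f p))"
proof (rule square_integrable_bound[OF assms, where c = "real n + \<nu>"])
  have [measurable]: "f \<in> borel_measurable borel"
    using square_integrable_measurable[OF assms] by simp
  show "(\<lambda>p. of_real (q p) * (indicator (low n) p *\<^sub>R f p)) \<in> borel_measurable lborel"
    by measurable
  have "q p * cmod (f p) \<le> (real n + \<nu>) * cmod (f p)" if "p \<in> low n" for p
    using that by (intro mult_right_mono) (auto simp: low_def q_def)
  then show "AE p in lborel. cmod (of_real (q p) * (indicator (low n) p *\<^sub>R f p)) \<le> (real n + \<nu>) * cmod (f p)"
    using nu_pos q_pos by (intro AE_I2) (auto simp: norm_mult indicator_def abs_of_pos)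
qed

text \<open>The preimage h under the resolvent has transform - q G, and pairing it with
  \<open>green_ft\<close> cancels q, so orthogonality to \<open>green\<close> is the vanishing of
  the integral. The \<open>green\<close> component is taken to be 0.\<close>

lemma inverse_fourier_in_Domain:
  assumes G: "square_integrable G" and qG: "square_integrable (\<lambda>p. of_real (q p) * G p)"
    and zero: "(LINT p|lborel. G p * cnj (exp (\<i> * of_real (p * a)))) = 0"
  shows "inverse_fourier (L2_of G) \<in> Domain (perturbed_generator \<Psi> \<nu> a)"
proof -
  define h where "h = inverse_fourier (L2_of (\<lambda>p. - (of_real (q p) * G p)))"
  note f = square_integrable_minus[OF qG]
  have "resolvent h = inverse_fourier (L2_of G)"
  proof (rule resolvent_eqI)
    show "AE p in lborel. - (of_real (q p) * rep_L2 (fourier (inverse_fourier (L2_of G))) p) = rep_L2 (fourier h) p"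
      unfolding h_def fourier_inverse_fourier
      using AE_rep_L2_of[OF f] AE_rep_L2_of[OF G] by eventually_elim simp
  qed
  moreover have "2 * pi * cinner h green = 0"
  proof -
    have "2 * pi * cinner h green = cinner (L2_of (\<lambda>p. - (of_real (q p) * G p))) (L2_of green_ft)"
      unfolding plancherel[symmetric] fourier_green by (simp add: h_def)
    also have "\<dots> = (LINT p|lborel. - (of_real (q p) * G p) * cnj (green_ft p))"
      by (rule cinner_L2_of[OF f square_integrable_green_ft])
    also have "\<dots> = (LINT p|lborel. - (G p * cnj (exp (\<i> * of_real (p * a)))))"
      by (intro Bochner_Integration.integral_cong) (simp_all add: green_ft_def)
    also have "\<dots> = 0" using zero by simp
    finally show ?thesis .
  qed
  ultimately have "cinner h green = 0 \<and> inverse_fourier (L2_of G) = resolvent h + 0 *\<^sub>C green" by simp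
  then show ?thesis unfolding perturbed_generator_eq Domain_iff by blast
qed

text \<open>The constraint at \<open>a\<close> is restored by a multiple of the character restricted to \<open>low N\<close>:
  the correction has norm of order \<open>1 / sqrt \<bar>low N\<bar>\<close>.\<close>

lemma dense_Domain: "closure (Domain (perturbed_generator \<Psi> \<nu> a)) = UNIV"
proof -
  have "\<exists>v\<in>Domain (perturbed_generator \<Psi> \<nu> a). dist v u < r" if "0 < r" for u r
  proof -
    define F where "F = rep_L2 (fourier u)"
    define e where "e p = exp (\<i> * complex_of_real (p * a))" for p
    \<comment> \<open>Two errors below d add up to 2 d = sqrt (2 pi) r, and the inverse transform
      divides norms by sqrt (2 pi).\<close>
    define d where "d = sqrt (2 * pi) * r / 2"
    have d: "0 < d" using that by (simp add: d_def)
    have F: "square_integrable F" unfolding F_def by (rule square_integrable_rep)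
    have e [measurable]: "e \<in> borel_measurable borel" unfolding e_def by measurable
    have ecmod [simp]: "cmod (e p) = 1" for p unfolding e_def by (rule norm_iexp)
    have ecnj: "e p * cnj (e p) = 1" for p
      using complex_norm_square[of "e p"] by simp
    let ?F = "\<lambda>n p. indicator (low n) p *\<^sub>R F p" and ?e = "\<lambda>n p. indicator (low n) p *\<^sub>R e p"
    have sF: "square_integrable (?F n)" for n by (rule square_integrable_low_mult[OF F])
    have se: "square_integrable (?e n)" for n by (rule square_integrable_low) simp_all
    obtain n where n: "norm (L2_of (?F n) - L2_of F) < d"
      using low_tendsto[OF F] d unfolding LIMSEQ_iff by blast
    define \<alpha> where "\<alpha> = (LINT p|lborel. ?F n p * cnj (e p))"
    \<comment> \<open>The truncation level n, and with it the defect \<alpha>, is fixed before N.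
      The choice makes |\<alpha>| / sqrt m, the norm of the correction, smaller than d.\<close>
    obtain N where "(cmod \<alpha> / d)\<^sup>2 < measure lborel (low N)" using measure_low_unbounded by blast
    moreover define m where "m = measure lborel (low N)"
    ultimately have m: "(cmod \<alpha> / d)\<^sup>2 < m" by simp
    then have m0: "0 < m" by (rule le_less_trans[OF zero_le_power2])
    define G where "G p = ?F n p - (\<alpha> / of_real m) * ?e N p" for p
    have sG: "square_integrable G"
      unfolding G_def by (intro square_integrable_diff square_integrable_scale sF se)
    have "inverse_fourier (L2_of G) \<in> Domain (perturbed_generator \<Psi> \<nu> a)"
    proof (rule inverse_fourier_in_Domain[OF sG])
      \<comment> \<open>The character itself is not square integrable, but its truncation is and
        equals its own truncation, so \<open>square_integrable_q_low_mult\<close> applies to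
        it.\<close>
      have "?e N = (\<lambda>p. indicator (low N) p *\<^sub>R ?e N p)" by (auto simp: indicator_def)
      then have qe: "square_integrable (\<lambda>p. of_real (q p) * ?e N p)"
        using square_integrable_q_low_mult[OF se, of N N] by metis
      have "square_integrable (\<lambda>p. of_real (q p) * ?F n p - (\<alpha> / of_real m) * (of_real (q p) * ?e N p))"
        by (intro square_integrable_diff square_integrable_scale square_integrable_q_low_mult F qe)
      then show "square_integrable (\<lambda>p. of_real (q p) * G p)"
        unfolding G_def by (simp add: right_diff_distrib mult.left_commute)
      have 1: "integrable lborel (\<lambda>p. ?F n p * cnj (e p))"
      proof -
        have "integrable lborel (\<lambda>p. ?F n p * cnj (?e n p))"
          by (rule square_integrable_mult[OF sF se])
        moreover have "?F n p * cnj (?e n p) = ?F n p * cnj (e p)" for p by (simp add: indicator_def)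
        ultimately show ?thesis by (simp only:)
      qed
      have eq: "?e N p * cnj (e p) = of_real (indicator (low N) p)" for p
        using ecnj by (simp add: indicator_def)
      have ind: "integrable lborel (indicator (low N) :: real \<Rightarrow> real)"
        using emeasure_low_finite by (intro integrable_real_indicator) auto
      then have 2: "integrable lborel (\<lambda>p. ?e N p * cnj (e p))"
        unfolding eq by (rule integrable_of_real)
      have 3: "(LINT p|lborel. ?e N p * cnj (e p)) = of_real m"
        unfolding eq integral_complex_of_real m_def by simp
      have "(LINT p|lborel. G p * cnj (e p))
          = (LINT p|lborel. ?F n p * cnj (e p) - (\<alpha> / of_real m) * (?e N p * cnj (e p)))"
        unfolding G_def by (simp add: left_diff_distrib mult.assoc)
      also have "\<dots> = \<alpha> - (\<alpha> / of_real m) * of_real m"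
        using Bochner_Integration.integral_diff[OF 1 integrable_mult_right[OF 2, of "\<alpha> / of_real m"]]
        by (simp only: integral_mult_right_zero 3 \<alpha>_def[symmetric])
      finally show "(LINT p|lborel. G p * cnj (exp (\<i> * of_real (p * a)))) = 0"
        using m0 by (simp add: e_def)
    qed
    moreover have "dist (inverse_fourier (L2_of G)) u < r"
    proof -
      have "(norm (L2_of (?e N)))\<^sup>2 = m"
      proof -
        have "(cmod (?e N p))\<^sup>2 = indicator (low N) p" for p by (simp add: indicator_def)
        then show ?thesis unfolding norm_L2_of[OF se] m_def by simp
      qed
      then have ne: "norm (L2_of (?e N)) = sqrt m" by (metis norm_ge_zero real_sqrt_unique)
      have LG: "L2_of G = L2_of (?F n) - (\<alpha> / of_real m) *\<^sub>C L2_of (?e N)"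
        unfolding G_def L2_of_scaleC[OF se] L2_of_diff[OF sF square_integrable_scale[OF se]] ..
      have "cmod \<alpha> / d < sqrt m" using m by (rule real_less_rsqrt)
      then have "cmod \<alpha> / sqrt m < d" using d m0 by (simp add: field_simps)
      moreover have "norm ((\<alpha> / of_real m) *\<^sub>C L2_of (?e N)) = cmod \<alpha> * (sqrt m / m)"
        using m0 by (simp add: norm_scaleC ne norm_divide)
      ultimately have small: "norm ((\<alpha> / of_real m) *\<^sub>C L2_of (?e N)) < d"
        using sqrt_divide_self_eq[of m] m0 by (simp add: inverse_eq_divide)
      have u: "u = inverse_fourier (L2_of F)" by (simp add: F_def)
      have "inverse_fourier (L2_of G) - u = inverse_fourier (L2_of G - L2_of F)"
      proof (rule fourier_inject)
        show "fourier (inverse_fourier (L2_of G) - u) = fourier (inverse_fourier (L2_of G - L2_of F))"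
          using fourier_add[of "inverse_fourier (L2_of G) - u" u] u by (simp add: eq_diff_eq)
      qed
      then have "dist (inverse_fourier (L2_of G)) u = norm (L2_of G - L2_of F) / sqrt (2 * pi)"
        by (simp add: dist_norm norm_inverse_fourier)
      moreover have "norm (L2_of G - L2_of F) < d + d"
      proof -
        have "norm (L2_of G - L2_of F) \<le> norm (L2_of (?F n) - L2_of F) + norm ((\<alpha> / of_real m) *\<^sub>C L2_of (?e N))"
          using norm_triangle_ineq4[of "L2_of (?F n) - L2_of F" "(\<alpha> / of_real m) *\<^sub>C L2_of (?e N)"]
          unfolding LG by (simp add: algebra_simps)
        also have "\<dots> < d + d" by (rule add_strict_mono[OF n small])
        finally show ?thesis .
      qed
      then have "norm (L2_of G - L2_of F) / sqrt (2 * pi) < (d + d) / sqrt (2 * pi)"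
        by (rule divide_strict_right_mono) simp
      moreover have "(d + d) / sqrt (2 * pi) = r" by (simp add: d_def)
      ultimately show ?thesis by simp
    qed
    ultimately show ?thesis by blast
  qed
  then show ?thesis by (auto simp: closure_approachable)
qed

section \<open>Linearity and the adjoint\<close>

lemma linear_operator_perturbed: "linear_operator (perturbed_generator \<Psi> \<nu> a)"
proof -
  let ?T = "perturbed_generator \<Psi> \<nu> a"
  have mem: "(u, z) \<in> ?T \<longleftrightarrow> (\<exists>h C. cinner h green = 0 \<and> u = resolvent h + C *\<^sub>C green \<and> z = h + of_real \<nu> *\<^sub>C u)" for u z
    unfolding perturbed_generator_eq by blast
  have "z = z'" if T: "(u, z) \<in> ?T" "(u, z') \<in> ?T" for u z z'
  proof -
    obtain h C h' C' where *: "cinner h green = 0" "u = resolvent h + C *\<^sub>C green" "z = h + of_real \<nu> *\<^sub>C u"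
      "cinner h' green = 0" "u = resolvent h' + C' *\<^sub>C green" "z' = h' + of_real \<nu> *\<^sub>C u"
      using T unfolding mem by blast
    \<comment> \<open>Two decompositions of one u differ by an h - h' orthogonal to
      \<open>green\<close> whose resolvent is a multiple of \<open>green\<close>; this is the
      situation excluded by \<open>resolvent_eq_green_imp_0\<close>.\<close>
    have "resolvent h - resolvent h' = C' *\<^sub>C green - C *\<^sub>C green"
      using *(2,5) by (simp add: algebra_simps)
    also have "\<dots> = (C' - C) *\<^sub>C green"
      using scaleC_add_left[of "C' - C" C green] by (simp add: eq_diff_eq)
    finally have "h - h' = 0"
      using *(1,4) by (intro resolvent_eq_green_imp_0[of _ "C' - C"]) (simp_all add: resolvent_diff cinner_diff_left)
    then show ?thesis using *(3,6) by simp
  qed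
  then have "single_valued ?T" by (auto simp: single_valued_def)
  moreover have "(0, 0) \<in> ?T"
    unfolding mem by (rule exI[of _ 0], rule exI[of _ 0]) simp
  moreover have "(u + v, z + w) \<in> ?T" if "(u, z) \<in> ?T" "(v, w) \<in> ?T" for u v z w
  proof -
    obtain h C where "cinner h green = 0" "u = resolvent h + C *\<^sub>C green" "z = h + of_real \<nu> *\<^sub>C u"
      using \<open>(u, z) \<in> ?T\<close> unfolding mem by blast
    moreover obtain g D where "cinner g green = 0" "v = resolvent g + D *\<^sub>C green" "w = g + of_real \<nu> *\<^sub>C v"
      using \<open>(v, w) \<in> ?T\<close> unfolding mem by blast
    ultimately have "cinner (h + g) green = 0" "u + v = resolvent (h + g) + (C + D) *\<^sub>C green"
      "z + w = (h + g) + of_real \<nu> *\<^sub>C (u + v)"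
      by (simp_all add: cinner_add_left resolvent_add scaleC_add scaleC_add_left)
    then show ?thesis unfolding mem by blast
  qed
  moreover have "(c *\<^sub>C u, c *\<^sub>C z) \<in> ?T" if "(u, z) \<in> ?T" for c u z
  proof -
    obtain h C where *: "cinner h green = 0" "u = resolvent h + C *\<^sub>C green" "z = h + of_real \<nu> *\<^sub>C u"
      using \<open>(u, z) \<in> ?T\<close> unfolding mem by blast
    then have "cinner (c *\<^sub>C h) green = 0" "c *\<^sub>C u = resolvent (c *\<^sub>C h) + (c * C) *\<^sub>C green"
      "c *\<^sub>C z = c *\<^sub>C h + of_real \<nu> *\<^sub>C c *\<^sub>C u"
      by (simp_all add: cinner_scaleC_left resolvent_scaleC scaleC_add scaleC_scaleC mult_ac)
    then show ?thesis unfolding mem by blast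
  qed
  ultimately show ?thesis unfolding linear_operator_def by blast
qed

text \<open>The component of d orthogonal to \<open>green\<close> is itself an admissible h, hence
  orthogonal to d and so to itself. If \<open>green\<close> were 0, division by 0 would give t = 0
  and the argument would still apply.\<close>

lemma orthogonal_complement_green:
  assumes "\<And>h. cinner h green = 0 \<Longrightarrow> cinner h d = 0"
  shows "\<exists>C. d = C *\<^sub>C green"
proof -
  define t where "t = cinner d green / cinner green green"
  have t: "cinner (d - t *\<^sub>C green) green = 0"
    by (cases "green = 0") (simp_all add: t_def cinner_diff_left cinner_scaleC_left)
  then have "cinner (d - t *\<^sub>C green) (d - t *\<^sub>C green) = 0"
    using assms[OF t] by (simp only: cinner_diff_right cinner_scaleC_right) simp
  then show ?thesis by auto
qed

lemma adjoint_perturbed: "adjoint (perturbed_generator \<Psi> \<nu> a) = perturbed_generator \<Psi> \<nu> a"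
proof (rule set_eqI, clarify)
  fix v w
  let ?T = "perturbed_generator \<Psi> \<nu> a"
  have mem: "(u, z) \<in> ?T \<longleftrightarrow> (\<exists>h C. cinner h green = 0 \<and> u = resolvent h + C *\<^sub>C green \<and> z = h + of_real \<nu> *\<^sub>C u)" for u z
    unfolding perturbed_generator_eq by blast
  have adj: "(v, w) \<in> adjoint ?T \<longleftrightarrow> (\<forall>u z. (u, z) \<in> ?T \<longrightarrow> cinner z v = cinner u w)"
    unfolding adjoint_def by auto
  have sym0: "cinner green g = 0" if "cinner g green = 0" for g
    using that by (subst cinner_commute) simp
  show "(v, w) \<in> adjoint ?T \<longleftrightarrow> (v, w) \<in> ?T"
  proof
    assume *: "(v, w) \<in> ?T"
    then obtain g D where v: "cinner g green = 0" "v = resolvent g + D *\<^sub>C green" "w = g + of_real \<nu> *\<^sub>C v"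
      unfolding mem by blast
    show "(v, w) \<in> adjoint ?T"
      unfolding adj
    proof (intro allI impI)
      fix u z assume "(u, z) \<in> ?T"
      then obtain h C where u: "cinner h green = 0" "u = resolvent h + C *\<^sub>C green" "z = h + of_real \<nu> *\<^sub>C u"
        unfolding mem by blast
      have "cinner h v = cinner u g"
        by (simp add: u(1,2) v(1,2) sym0 cinner_add_left cinner_add_right cinner_scaleC_left
            cinner_scaleC_right cinner_resolvent)
      then show "cinner z v = cinner u w"
        by (simp add: u(3) v(3) cinner_add_left cinner_add_right cinner_scaleC_left cinner_scaleC_right)
    qed
  next
    assume *: "(v, w) \<in> adjoint ?T"
    \<comment> \<open>As \<nu> is real, passing from w to w - \<nu> v replaces the operator by its
      shift by - \<nu>, which sends \<open>resolvent h + C *\<^sub>C green\<close> to h.\<close>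
    define g where "g = w - of_real \<nu> *\<^sub>C v"
    have key: "cinner h v = cinner (resolvent h + C *\<^sub>C green) g" if "cinner h green = 0" for h C
    proof -
      let ?u = "resolvent h + C *\<^sub>C green"
      have "(?u, h + of_real \<nu> *\<^sub>C ?u) \<in> ?T" unfolding mem using that by blast
      then have "cinner (h + of_real \<nu> *\<^sub>C ?u) v = cinner ?u w" using * unfolding adj by blast
      then show ?thesis
        unfolding g_def cinner_diff_right
        by (simp only: cinner_add_left[of h] cinner_scaleC_left cinner_scaleC_right
            complex_cnj_complex_of_real eq_diff_eq)
    qed
    \<comment> \<open>Testing with h = 0 uses the kernel and makes g orthogonal to
      \<open>green\<close>; testing with C = 0 below uses the range and leaves v -
      \<open>resolvent g\<close> only the direction of \<open>green\<close>.\<close>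
    have g: "cinner g green = 0"
      using key[of 0 1] by (subst cinner_commute) simp
    have "cinner h (v - resolvent g) = 0" if "cinner h green = 0" for h
      using key[OF that, of 0] by (simp add: cinner_diff_right cinner_resolvent)
    then obtain C where "v - resolvent g = C *\<^sub>C green"
      using orthogonal_complement_green by blast
    then have "v = resolvent g + C *\<^sub>C green" by (simp add: diff_eq_eq add.commute)
    moreover have "w = g + of_real \<nu> *\<^sub>C v" by (simp add: g_def)
    ultimately show "(v, w) \<in> ?T" unfolding mem using g by blast
  qed
qed

theorem self_adjoint_perturbed: "self_adjoint (perturbed_generator \<Psi> \<nu> a)"
  unfolding self_adjoint_def
  using linear_operator_perturbed dense_Domain adjoint_perturbed by blast

end

theorem theorem4p2:
  fixes M :: "'w measure" and \<xi> :: "real \<Rightarrow> 'w \<Rightarrow> real"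
    and \<Lambda> :: "real measure" and \<sigma> \<mu> \<nu> a :: real
  assumes "levy_process M \<xi>" and "symmetric_process M \<xi>"
    and "symmetric_levy_measure \<Lambda>"
    and "\<And>t p. t \<ge> 0 \<Longrightarrow>
           char (distr M borel (\<xi> t)) p = of_real (exp (- t * levy_exponent \<sigma> \<Lambda> p))"
    and "integrable lborel (\<lambda>p. 1 / (1 + levy_exponent \<sigma> \<Lambda> p))"
    and "\<mu> > 0" and "\<nu> > 0"
    and "of_real \<mu> * psi (levy_exponent \<sigma> \<Lambda>) (of_real \<nu>) 0 = 1"
  shows "self_adjoint (perturbed_generator (levy_exponent \<sigma> \<Lambda>) \<nu> a)"
proof (rule point_perturbation.self_adjoint_perturbed, unfold_locales)
  let ?\<Psi> = "levy_exponent \<sigma> \<Lambda>"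
  \<comment> \<open>Measurability of the exponent is read off the process: at time 1 the
    characteristic function is exp (- \<Psi>), so \<Psi> is minus its logarithm.\<close>
  have "real_distribution (distr M borel (\<xi> 1))"
    using assms(1) by (intro prob_space.real_distribution_distr) (auto simp: levy_process_def)
  then have "char (distr M borel (\<xi> 1)) \<in> borel_measurable borel"
    by (rule real_distribution.char_measurable)
  then have "(\<lambda>p. - ln (Re (char (distr M borel (\<xi> 1)) p))) \<in> borel_measurable borel"
    by measurable
  moreover have "- ln (Re (char (distr M borel (\<xi> 1)) p)) = ?\<Psi> p" for p
    using assms(4)[of 1 p] by simp
  ultimately show "?\<Psi> \<in> borel_measurable borel" by simp
  \<comment> \<open>The integrand 1 - cos is nonnegative, and a Bochner integral of a nonnegative
    function is nonnegative even where it takes the default value 0.\<close>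
  show "0 \<le> ?\<Psi> p" for p
    unfolding levy_exponent_def set_lebesgue_integral_def
    by (intro add_nonneg_nonneg Bochner_Integration.integral_nonneg) auto
  show "psi ?\<Psi> (of_real \<nu>) 0 \<noteq> 0"
    using assms(8) by auto
qed (use assms in auto)

end
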